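(* Let $\lambda_2,\dots,\lambda_n\in\mathbb{C}$ be such that $E_{(\lambda_2,\dots,\lambda_n)}$ is closed under complex conjugation, let $M_n:=\max\{|\mathrm{Im}\,\lambda_j|:j=2,\dots,n\}$, and let $a<b$ with $b-a<\pi/M_n$ (no restriction if $M_n=0$). Let $\lambda_0<\lambda_1$ be real. Then for each $k=0,\dots,n-1$, $$\lim_{x\to b}\frac{p_{(\lambda_0,\lambda_2,\dots,\lambda_n),k}(x)}{p_{(\lambda_1,\lambda_2,\dots,\lambda_n),k}(x)}<1,$$ and for each $x\in(a,b)$ the function $\mathbb{R}\ni\lambda\mapsto p_{(\lambda,\lambda_2,\dots,\lambda_n),k}(x)$ is (real-valued and) strictly increasing.
   Context: $E_{(\mu_0,\dots,\mu_m)}$ denotes the space of all $f\in C^\infty(\mathbb{R},\mathbb{C})$ with $(\frac{d}{dx}-\mu_0)\cdots(\frac{d}{dx}-\mu_m)f=0$ (dimension $m+1$); it is closed under complex conjugation if $\overline f$ lies in it whenever $f$ does. A zero of order (exactly) $k$ at $a$ means $f(a)=\dots=f^{(k-1)}(a)=0$, $f^{(k)}(a)\neq0$. The space is an extended Chebyshev system over $A\subset\mathbb{R}$ if every nonzero element has at most $m$ zeros in $A$ counted with multiplicity; under the hypotheses here all spaces involved (obtained by adjoining real eigenvalues) are extended Chebyshev systems over $[a,b]$. For such a space and $a\ne b$, the Bernstein basis $p_{(\mu_0,\dots,\mu_m),k}$, $k=0,\dots,m$, is the unique family in the space with $p_{(\mu_0,\dots,\mu_m),k}$ having a zero of order exactly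 $k$ at $a$, exactly $m-k$ at $b$, and $p^{(k)}_{(\mu_0,\dots,\mu_m),k}(a)=1$. *)

theory Defs
  imports "HOL-Analysis.Analysis"
begin

fun vderiv :: "nat \<Rightarrow> (real \<Rightarrow> complex) \<Rightarrow> real \<Rightarrow> complex" where
  "vderiv 0 f = f"
| "vderiv (Suc k) f = (\<lambda>x. vector_derivative (vderiv k f) (at x))"

definition smooth_fun :: "(real \<Rightarrow> complex) \<Rightarrow> bool" where
  "smooth_fun f \<longleftrightarrow> (\<forall>k x. vderiv k f differentiable (at x))"

fun diff_op :: "complex list \<Rightarrow> (real \<Rightarrow> complex) \<Rightarrow> real \<Rightarrow> complex" where
  "diff_op [] f = f"
| "diff_op (mu # mus) f =
     (\<lambda>x. vector_derivative (diff_op mus f) (at x) - mu * diff_op mus f x)"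

definition E_space :: "complex list \<Rightarrow> (real \<Rightarrow> complex) set" where
  "E_space mus = {f. smooth_fun f \<and> (\<forall>x. diff_op mus f x = 0)}"

definition closed_under_cnj :: "complex list \<Rightarrow> bool" where
  "closed_under_cnj mus \<longleftrightarrow> (\<forall>f\<in>E_space mus. (\<lambda>x. cnj (f x)) \<in> E_space mus)"

definition zero_order :: "(real \<Rightarrow> complex) \<Rightarrow> real \<Rightarrow> nat \<Rightarrow> bool" where
  "zero_order f a k \<longleftrightarrow> (\<forall>j<k. vderiv j f a = 0) \<and> vderiv k f a \<noteq> 0"

definition bernstein :: "real \<Rightarrow> real \<Rightarrow> complex list \<Rightarrow> nat \<Rightarrow> real \<Rightarrow> complex" where
  "bernstein a b mus k = (THE p. p \<in> E_space mus \<and> zero_order p a k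
      \<and> zero_order p b (length mus - 1 - k) \<and> vderiv k p a = 1)"

definition max_im :: "complex list \<Rightarrow> real" where
  "max_im ls = Max (insert 0 ((\<lambda>z. \<bar>Im z\<bar>) ` set ls))"

end

theory Submission
  imports Defs
begin

text \<open>Write $E$ for the space of a conjugation-closed list with real eigenvalues adjoined. Each
  conjugate pair of factors $(D-\mu)(D-\overline\mu)$ splits on $[a,b]$ into two real first-order factors $D-h'/h$
  with $h>0$, because $b-a<\pi/|\mathrm{Im}\,\mu|$; Rolle's theorem then makes $E$ an extended
  Chebyshev system, which gives existence, uniqueness, realness and positivity of the Bernstein basis.

  Let $L$ be the operator with eigenvalues $\lambda_2,\dots,\lambda_n$ and let $p,q$ be the $k$-th
  Bernstein functions for $\lambda_0$ and $\lambda_1$. Then $q-p$ has a zero of order $k+1$ at $a$ and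
  the same vanishing as $p,q$ at $b$, so $q-p=sP$ with $P$ the $(k+1)$-st Bernstein function for
  $(\lambda_1,\lambda_0,\lambda_2,\dots,\lambda_n)$. Now $Lq=c\,e^{\lambda_1x}$ and
  $(D-\lambda_0)LP=C\,e^{\lambda_1x}$, where $c$ and $C$ have the same sign, and comparing gives
  $sC=(\lambda_1-\lambda_0)c$. Hence $s>0$.\<close>

section \<open>Smooth functions and the operators $D-\mu$\<close>

text \<open>The sign of \<open>c\<close> is governed by the order \<open>d\<close> of the zero at
  \<open>b\<close>: the operator of the remaining eigenvalues turns a Bernstein function into a
  multiple of an exponential, and that multiple has sign \<open>(-1) ^ d\<close>. Passing from
  \<open>q\<close> to \<open>P\<close> raises the index and the dimension together and so keeps
  \<open>d\<close>; this is why \<open>c\<close> and \<open>C\<close> agree in sign. The relation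
  between them comes from the last factor, which annihilates the image of \<open>p\<close> and
  multiplies the exponential with exponent \<open>l1\<close> by \<open>l1 - l0\<close>. Pointwise
  monotonicity alone gives only a limit at most 1; strictness uses that the zero of \<open>P\<close>
  at \<open>b\<close> has order exactly \<open>d\<close>. Two obstacles shape the rest. The closure
  hypothesis speaks of the space, so the pairing of conjugate eigenvalues, with multiplicities, has
  to be recovered from it. And the positive weights exist only on \<open>[a, b]\<close>, so Rolle's
  theorem yields vanishing there, while Bernstein functions are functions on the whole line.\<close>

lemma smooth_fun_has_deriv:
  assumes "smooth_fun f"
  shows "(f has_vector_derivative vderiv 1 f x) (at x)"
proof -
  have "vderiv 0 f differentiable (at x)"
    using assms unfolding smooth_fun_def by blast
  then show ?thesis
    by (simp add: vector_derivative_works)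
qed

lemma vderiv_Suc': "vderiv (Suc k) f = vderiv k (vderiv 1 f)"
  by (induction k) auto

lemma vderiv_1_eqI: "(\<And>x. (f has_vector_derivative g x) (at x)) \<Longrightarrow> vderiv 1 f = g"
  by (auto simp: fun_eq_iff intro: vector_derivative_at)

lemma smooth_fun_vderiv:
  assumes "smooth_fun f"
  shows "smooth_fun (vderiv 1 f)"
  using assms unfolding smooth_fun_def vderiv_Suc'[symmetric] by blast

text \<open>Smoothness is the largest property stable under differentiation, so it suffices to
  exhibit a stable class containing \<open>f\<close>. The classes used below are linear
  combinations, conjugates and multiples of an exponential.\<close>

lemma smooth_fun_coinduct:
  assumes "P f"
    and step: "\<And>f. P f \<Longrightarrow> \<exists>g. (\<forall>x. (f has_vector_derivative g x) (at x)) \<and> P g"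
  shows "smooth_fun f"
proof -
  have "P (vderiv k f)" for k
  proof (induction k)
    case (Suc k)
    then obtain g where g: "\<forall>x. (vderiv k f has_vector_derivative g x) (at x)" "P g"
      using step by blast
    then have "vderiv (Suc k) f = g"
      by (auto simp: fun_eq_iff intro: vector_derivative_at)
    with g show ?case by simp
  qed (simp add: assms)
  then show ?thesis
    unfolding smooth_fun_def using step differentiableI_vector by blast
qed

lemma has_vector_derivative_lincomb:
  fixes f g :: "real \<Rightarrow> complex"
  assumes "(f has_vector_derivative f') F" "(g has_vector_derivative g') F"
  shows "((\<lambda>x. c * f x + d * g x) has_vector_derivative (c * f' + d * g')) F"
  using assms
  by (intro has_vector_derivative_add bounded_linear.has_vector_derivative[OF bounded_linear_mult_right])

lemma smooth_fun_lincomb: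
  assumes "smooth_fun f" "smooth_fun g"
  shows "smooth_fun (\<lambda>x. c * f x + d * g x)"
proof (rule smooth_fun_coinduct
    [where P = "\<lambda>h. \<exists>f g. smooth_fun f \<and> smooth_fun g \<and> h = (\<lambda>x. c * f x + d * g x)"])
  fix h assume "\<exists>f g. smooth_fun f \<and> smooth_fun g \<and> h = (\<lambda>x. c * f x + d * g x)"
  then obtain f g where fg: "smooth_fun f" "smooth_fun g" "h = (\<lambda>x. c * f x + d * g x)"
    by blast
  have "(h has_vector_derivative c * vderiv 1 f x + d * vderiv 1 g x) (at x)" for x
    unfolding fg(3)
    by (intro has_vector_derivative_lincomb smooth_fun_has_deriv fg)
  then show "\<exists>h'. (\<forall>x. (h has_vector_derivative h' x) (at x)) \<and>
      (\<exists>f g. smooth_fun f \<and> smooth_fun g \<and> h' = (\<lambda>x. c * f x + d * g x))"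
    using smooth_fun_vderiv fg(1,2)
    by (intro exI[of _ "\<lambda>x. c * vderiv 1 f x + d * vderiv 1 g x"]) blast
qed (use assms in blast)

lemma vderiv_lincomb:
  assumes "smooth_fun f" "smooth_fun g"
  shows "vderiv k (\<lambda>x. c * f x + d * g x) = (\<lambda>x. c * vderiv k f x + d * vderiv k g x)"
  using assms
proof (induction k arbitrary: f g)
  case (Suc k)
  have "vderiv 1 (\<lambda>x. c * f x + d * g x) = (\<lambda>x. c * vderiv 1 f x + d * vderiv 1 g x)"
    by (intro vderiv_1_eqI has_vector_derivative_lincomb smooth_fun_has_deriv Suc.prems)
  then show ?case
    unfolding vderiv_Suc' using Suc smooth_fun_vderiv by presburger
qed simp

lemma smooth_fun_zero: "smooth_fun (\<lambda>x. 0)"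
  by (rule smooth_fun_coinduct[where P = "\<lambda>h. h = (\<lambda>x. 0)"])
    (auto intro: has_vector_derivative_const)

lemma vderiv_cmult: "smooth_fun f \<Longrightarrow> vderiv k (\<lambda>x. c * f x) = (\<lambda>x. c * vderiv k f x)"
  using vderiv_lincomb[of f f k c 0] by simp

lemma smooth_fun_diff: "smooth_fun f \<Longrightarrow> smooth_fun g \<Longrightarrow> smooth_fun (\<lambda>x. f x - g x)"
  using smooth_fun_lincomb[of f g 1 "-1"] by simp

lemma vderiv_diff:
  "smooth_fun f \<Longrightarrow> smooth_fun g \<Longrightarrow> vderiv k (\<lambda>x. f x - g x) = (\<lambda>x. vderiv k f x - vderiv k g x)"
  using vderiv_lincomb[of f g k 1 "-1"] by simp

lemma vderiv_1_cnj:
  assumes "smooth_fun f"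
  shows "vderiv 1 (\<lambda>x. cnj (f x)) = (\<lambda>x. cnj (vderiv 1 f x))"
  by (intro vderiv_1_eqI bounded_linear.has_vector_derivative[OF bounded_linear_cnj]
      smooth_fun_has_deriv assms)

lemma smooth_fun_cnj:
  assumes "smooth_fun f"
  shows "smooth_fun (\<lambda>x. cnj (f x))"
proof (rule smooth_fun_coinduct
    [where P = "\<lambda>h. \<exists>f. smooth_fun f \<and> h = (\<lambda>x. cnj (f x))"])
  fix h assume "\<exists>f. smooth_fun f \<and> h = (\<lambda>x. cnj (f x))"
  then obtain f where f: "smooth_fun f" "h = (\<lambda>x. cnj (f x))" by blast
  then have "(h has_vector_derivative cnj (vderiv 1 f x)) (at x)" for x
    using bounded_linear.has_vector_derivative[OF bounded_linear_cnj] smooth_fun_has_deriv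
    by blast
  then show "\<exists>g. (\<forall>x. (h has_vector_derivative g x) (at x)) \<and>
      (\<exists>f. smooth_fun f \<and> g = (\<lambda>x. cnj (f x)))"
    using smooth_fun_vderiv f(1) by (intro exI[of _ "\<lambda>x. cnj (vderiv 1 f x)"]) blast
qed (use assms in blast)

lemma vderiv_cnj:
  assumes "smooth_fun f"
  shows "vderiv k (\<lambda>x. cnj (f x)) = (\<lambda>x. cnj (vderiv k f x))"
  using assms
proof (induction k arbitrary: f)
  case (Suc k)
  then show ?case
    unfolding vderiv_Suc' vderiv_1_cnj[OF Suc.prems] using smooth_fun_vderiv by blast
qed simp

lemma has_vector_derivative_exp_real:
  "((\<lambda>x. exp (mu * complex_of_real x)) has_vector_derivative mu * exp (mu * complex_of_real x)) (at x)"
proof -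
  have "((\<lambda>z. exp (mu * z)) has_field_derivative exp (mu * of_real x) * mu) (at (of_real x))"
    by (auto intro!: derivative_eq_intros)
  from has_vector_derivative_real_field[OF this] show ?thesis
    by (simp add: mult.commute o_def)
qed

lemma smooth_fun_exp: "smooth_fun (\<lambda>x. exp (mu * complex_of_real x))"
proof (rule smooth_fun_coinduct
    [where P = "\<lambda>h. \<exists>c. h = (\<lambda>x. c * exp (mu * complex_of_real x))"])
  fix h assume "\<exists>c. h = (\<lambda>x. c * exp (mu * complex_of_real x))"
  then obtain c where h: "h = (\<lambda>x. c * exp (mu * complex_of_real x))" by blast
  have "(h has_vector_derivative (c * mu) * exp (mu * complex_of_real x)) (at x)" for x
    unfolding h mult.assoc
    by (intro bounded_linear.has_vector_derivative[OF bounded_linear_mult_right]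
        has_vector_derivative_exp_real)
  then show "\<exists>g. (\<forall>x. (h has_vector_derivative g x) (at x)) \<and>
      (\<exists>c. g = (\<lambda>x. c * exp (mu * complex_of_real x)))"
    by (intro exI[of _ "\<lambda>x. (c * mu) * exp (mu * complex_of_real x)"]) blast
qed (rule exI[of _ 1], simp)

text \<open>Phrased with \<open>vderiv 1\<close>, so that the rules for derivatives of smooth
  functions apply directly to a single factor of \<open>diff_op\<close>.\<close>

definition dstep :: "complex \<Rightarrow> (real \<Rightarrow> complex) \<Rightarrow> real \<Rightarrow> complex" where
  "dstep mu f = (\<lambda>x. vderiv 1 f x - mu * f x)"

lemma diff_op_Cons': "diff_op (mu # mus) f = dstep mu (diff_op mus f)"
  by (simp add: dstep_def)

lemma diff_op_append: "diff_op (xs @ ys) f = diff_op xs (diff_op ys f)"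
  by (induction xs) auto

lemma diff_op_single: "diff_op [mu] f = dstep mu f"
  by (simp add: dstep_def)

lemma dstep_conv_lincomb:
  "dstep mu f = (\<lambda>x. 1 * vderiv 1 f x + (- mu) * f x)"
  by (simp add: dstep_def)

lemma smooth_fun_dstep: "smooth_fun f \<Longrightarrow> smooth_fun (dstep mu f)"
  unfolding dstep_conv_lincomb by (intro smooth_fun_lincomb smooth_fun_vderiv)

lemma vderiv_dstep:
  "smooth_fun f \<Longrightarrow> vderiv k (dstep mu f) x = vderiv (Suc k) f x - mu * vderiv k f x"
  unfolding dstep_conv_lincomb vderiv_Suc'
  by (subst vderiv_lincomb) (use smooth_fun_vderiv in blast, assumption, simp only: mult_minus_left mult_1 add_uminus_conv_diff)

lemma smooth_fun_diff_op: "smooth_fun f \<Longrightarrow> smooth_fun (diff_op mus f)"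
proof (induction mus)
  case (Cons mu mus)
  then show ?case unfolding diff_op_Cons' using smooth_fun_dstep by blast
qed simp

lemma dstep_lincomb:
  assumes "smooth_fun f" "smooth_fun g"
  shows "dstep mu (\<lambda>x. c * f x + d * g x) = (\<lambda>x. c * dstep mu f x + d * dstep mu g x)"
  unfolding dstep_def vderiv_lincomb[OF assms] by (simp add: algebra_simps)

lemma diff_op_lincomb:
  assumes "smooth_fun f" "smooth_fun g"
  shows "diff_op mus (\<lambda>x. c * f x + d * g x) = (\<lambda>x. c * diff_op mus f x + d * diff_op mus g x)"
proof (induction mus)
  case (Cons mu mus)
  then show ?case
    unfolding diff_op_Cons' using dstep_lincomb smooth_fun_diff_op assms by presburger
qed simp

lemma diff_op_zero: "diff_op mus (\<lambda>x. 0) = (\<lambda>x. 0)"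
  using diff_op_lincomb[OF smooth_fun_zero smooth_fun_zero, of mus 0 0] by simp

lemma E_space_iff: "f \<in> E_space mus \<longleftrightarrow> smooth_fun f \<and> diff_op mus f = (\<lambda>x. 0)"
  by (auto simp: E_space_def)

lemma E_space_lincomb:
  assumes "f \<in> E_space mus" "g \<in> E_space mus"
  shows "(\<lambda>x. c * f x + d * g x) \<in> E_space mus"
  using assms by (simp add: E_space_iff diff_op_lincomb smooth_fun_lincomb)

lemma E_space_cmult: "f \<in> E_space mus \<Longrightarrow> (\<lambda>x. c * f x) \<in> E_space mus"
  using E_space_lincomb[of f mus f c 0] by simp

lemma E_space_diff: "f \<in> E_space mus \<Longrightarrow> g \<in> E_space mus \<Longrightarrow> (\<lambda>x. f x - g x) \<in> E_space mus"
  using E_space_lincomb[of f mus g 1 "-1"] by simp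

lemma E_space_Cons_subset: "f \<in> E_space mus \<Longrightarrow> f \<in> E_space (mu # mus)"
  using diff_op_zero[of "[mu]"] by (simp add: E_space_iff)

section \<open>Independence of the order of the factors\<close>

lemma dstep_commute:
  assumes "smooth_fun f"
  shows "dstep mu (dstep nu f) = dstep nu (dstep mu f)"
proof
  fix x
  show "dstep mu (dstep nu f) x = dstep nu (dstep mu f) x"
    unfolding dstep_def[of mu "dstep nu f"] dstep_def[of nu "dstep mu f"] vderiv_dstep[OF assms]
    by (simp add: dstep_def algebra_simps)
qed

lemma diff_op_dstep_commute:
  assumes "smooth_fun f"
  shows "diff_op mus (dstep mu f) = dstep mu (diff_op mus f)"
proof (induction mus)
  case (Cons nu mus)
  then show ?case
    unfolding diff_op_Cons' using dstep_commute smooth_fun_diff_op assms by metis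
qed simp

lemma diff_op_mset_cong:
  assumes "mset xs = mset ys" "smooth_fun f"
  shows "diff_op xs f = diff_op ys f"
  using assms(1)
proof (induction xs arbitrary: ys)
  case (Cons x xs)
  then have "x \<in> set ys" by (metis list.set_intros(1) set_mset_mset)
  then obtain us vs where ys: "ys = us @ x # vs" by (meson split_list)
  then have "mset xs = mset (us @ vs)" using Cons.prems by simp
  then have "diff_op (x # xs) f = dstep x (diff_op us (diff_op vs f))"
    unfolding diff_op_Cons' using Cons.IH diff_op_append by metis
  also have "\<dots> = diff_op ys f"
    unfolding ys diff_op_append diff_op_Cons'
    using diff_op_dstep_commute smooth_fun_diff_op assms(2) by metis
  finally show ?case .
qed simp

lemma E_space_mset_cong: "mset xs = mset ys \<Longrightarrow> E_space xs = E_space ys"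
  by (auto simp: E_space_iff dest: diff_op_mset_cong)

text \<open>Integrating factor: \<open>f\<close> is exp(mu x) times an antiderivative of exp(-mu x)
  F.\<close>

lemma ex_dstep_eq:
  assumes "smooth_fun F"
  shows "\<exists>f. smooth_fun f \<and> dstep mu f = F"
proof -
  let ?e = "\<lambda>nu x. exp (nu * complex_of_real x)"
  have "isCont (\<lambda>x. ?e (-mu) x * F x) x" for x
    using smooth_fun_has_deriv[OF assms, of x]
    by (intro continuous_intros has_vector_derivative_continuous) auto
  then obtain G where G: "(G has_vector_derivative ?e (-mu) x * F x) (at x)" for x
    using einterval_antiderivative[of "-\<infinity>" "\<infinity>" "\<lambda>x. ?e (-mu) x * F x"] by auto
  define f where "f = (\<lambda>x. ?e mu x * G x)"
  have f': "(f has_vector_derivative mu * f x + F x) (at x)" for x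
  proof -
    have "(f has_vector_derivative ?e mu x * (?e (-mu) x * F x) + mu * ?e mu x * G x) (at x)"
      unfolding f_def by (intro has_vector_derivative_mult has_vector_derivative_exp_real G)
    moreover have "?e mu x * (?e (-mu) x * F x) = F x"
      by (simp add: exp_minus field_simps)
    ultimately have "(f has_vector_derivative F x + mu * ?e mu x * G x) (at x)" by metis
    then show ?thesis by (simp add: f_def add.commute mult.assoc)
  qed
  have "smooth_fun f"
  \<comment> \<open>Since f' = mu f + F, the derivative of c f + H is (c mu) f + (c F + H'), again
    of this form.\<close>
  proof (rule smooth_fun_coinduct
      [where P = "\<lambda>h. \<exists>c H. smooth_fun H \<and> h = (\<lambda>x. c * f x + H x)"])
    fix h assume "\<exists>c H. smooth_fun H \<and> h = (\<lambda>x. c * f x + H x)"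
    then obtain c H where h: "smooth_fun H" "h = (\<lambda>x. c * f x + H x)" by blast
    let ?K = "\<lambda>x. c * F x + 1 * vderiv 1 H x"
    have "(h has_vector_derivative (c * mu) * f x + ?K x) (at x)" for x
      using has_vector_derivative_lincomb[OF f'[of x] smooth_fun_has_deriv[OF h(1), of x], of c 1]
      by (simp add: h(2) algebra_simps)
    moreover have "smooth_fun ?K"
      using smooth_fun_lincomb smooth_fun_vderiv assms h(1) by blast
    ultimately show "\<exists>g. (\<forall>x. (h has_vector_derivative g x) (at x)) \<and>
        (\<exists>c H. smooth_fun H \<and> g = (\<lambda>x. c * f x + H x))"
      by (intro exI[of _ "\<lambda>x. (c * mu) * f x + ?K x"]) blast
  qed (rule exI[of _ 1], rule exI[of _ "\<lambda>x. 0"], simp add: smooth_fun_zero)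
  moreover have "dstep mu f = F"
    unfolding dstep_def using vderiv_1_eqI[OF f'] by simp
  ultimately show ?thesis by blast
qed

lemma ex_diff_op_eq:
  assumes "smooth_fun F"
  shows "\<exists>f. smooth_fun f \<and> diff_op mus f = F"
  using assms
proof (induction mus arbitrary: F)
  case (Cons mu mus)
  then show ?case unfolding diff_op_Cons' using ex_dstep_eq by metis
qed auto

section \<open>Homogeneous first-order equations and exponentials\<close>

lemma dstep_eq_0_imp_exp:
  assumes "smooth_fun f" "dstep mu f = (\<lambda>x. 0)"
  shows "f x = f a * exp (mu * complex_of_real (x - a))"
proof -
  let ?h = "\<lambda>x. exp (- mu * complex_of_real x) * f x"
  have "(?h has_vector_derivative 0) (at x within UNIV)" for x
  proof -
    have "vderiv 1 f x = mu * f x"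
      using fun_cong[OF assms(2), of x] by (simp add: dstep_def)
    moreover have "(?h has_vector_derivative exp (- mu * complex_of_real x) * vderiv 1 f x
        + (- mu * exp (- mu * complex_of_real x)) * f x) (at x)"
      by (intro has_vector_derivative_mult has_vector_derivative_exp_real smooth_fun_has_deriv assms)
    ultimately show ?thesis by (simp add: algebra_simps)
  qed
  then obtain c where c: "\<And>x. ?h x = c"
    using has_vector_derivative_zero_constant[of UNIV ?h] by auto
  have "?h x = ?h a" using c by metis
  then show ?thesis
    by (simp add: exp_minus exp_diff right_diff_distrib field_simps)
qed

lemma dstep_exp:
  "dstep mu (\<lambda>x. c * exp (nu * complex_of_real x)) = (\<lambda>x. (nu - mu) * c * exp (nu * complex_of_real x))"
proof -
  have "vderiv 1 (\<lambda>x. c * exp (nu * complex_of_real x)) = (\<lambda>x. c * (nu * exp (nu * complex_of_real x)))"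
    by (intro vderiv_1_eqI bounded_linear.has_vector_derivative[OF bounded_linear_mult_right]
        has_vector_derivative_exp_real)
  then show ?thesis by (simp add: dstep_def algebra_simps)
qed

lemma diff_op_exp:
  "diff_op mus (\<lambda>x. exp (nu * complex_of_real x))
    = (\<lambda>x. (\<Prod>mu\<leftarrow>mus. nu - mu) * exp (nu * complex_of_real x))"
proof (induction mus)
  case (Cons mu mus)
  then show ?case unfolding diff_op_Cons' using dstep_exp by simp
qed simp

section \<open>Conjugation-symmetric lists\<close>

text \<open>Entries are appended at the end because the last factors of \<open>diff_op\<close> act
  first: peeling them off replaces \<open>f\<close> by its image in the space of the shorter
  list.\<close>

inductive conj_list :: "complex list \<Rightarrow> bool" where
  Nil: "conj_list []"
| real: "conj_list xs \<Longrightarrow> conj_list (xs @ [complex_of_real r])"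
| pair: "conj_list xs \<Longrightarrow> Im mu \<noteq> 0 \<Longrightarrow> conj_list (xs @ [mu, cnj mu])"

text \<open>Only the multiset matters, as \<open>E_space\<close> does not depend on the order of the
  eigenvalues.\<close>

definition conj_sym :: "complex list \<Rightarrow> bool" where
  "conj_sym mus \<longleftrightarrow> (\<exists>xs. conj_list xs \<and> mset xs = mset mus)"

lemma dstep_cnj:
  assumes "smooth_fun f"
  shows "dstep mu (\<lambda>x. cnj (f x)) = (\<lambda>x. cnj (dstep (cnj mu) f x))"
  unfolding dstep_def vderiv_1_cnj[OF assms] by simp

text \<open>Conjugation swaps the two factors of a pair, and commutativity swaps them back; a real
  factor is left alone.\<close>

lemma diff_op_cnj:
  assumes "conj_list xs" "smooth_fun f"
  shows "diff_op xs (\<lambda>x. cnj (f x)) = (\<lambda>x. cnj (diff_op xs f x))"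
  using assms
proof (induction arbitrary: f rule: conj_list.induct)
  case (real xs r)
  then show ?case
    using smooth_fun_dstep[OF real.prems] by (simp only: diff_op_append diff_op_single dstep_cnj complex_cnj_complex_of_real)
next
  case (pair xs mu)
  note sm = smooth_fun_dstep[OF pair.prems]
  have "diff_op [mu, cnj mu] (\<lambda>x. cnj (f x)) = (\<lambda>x. cnj (diff_op [mu, cnj mu] f x))"
    unfolding diff_op_Cons' diff_op.simps(1) dstep_cnj[OF pair.prems]
    using dstep_cnj[OF sm] dstep_commute[OF pair.prems] by simp
  then show ?case
    unfolding diff_op_append using pair.IH[OF smooth_fun_diff_op[OF pair.prems]] by (simp only:)
qed simp

lemma E_space_cnj:
  assumes "conj_sym mus" "f \<in> E_space mus"
  shows "(\<lambda>x. cnj (f x)) \<in> E_space mus"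
proof -
  obtain xs where xs: "conj_list xs" "mset xs = mset mus"
    using assms(1) unfolding conj_sym_def by blast
  have "f \<in> E_space xs" using assms(2) E_space_mset_cong[OF xs(2)] by simp
  then have "(\<lambda>x. cnj (f x)) \<in> E_space xs"
    unfolding E_space_iff using diff_op_cnj[OF xs(1)] smooth_fun_cnj by simp
  then show ?thesis using E_space_mset_cong[OF xs(2)] by simp
qed

lemma conj_sym_Cons_real:
  assumes "conj_sym mus"
  shows "conj_sym (complex_of_real r # mus)"
proof -
  obtain xs where "conj_list xs" "mset xs = mset mus"
    using assms unfolding conj_sym_def by blast
  then show ?thesis
    unfolding conj_sym_def
    by (intro exI[of _ "xs @ [complex_of_real r]"]) (simp add: conj_list.real)
qed

text \<open>\<open>diff_op ys\<close> is onto the smooth functions, so \<open>f\<close> lifts to an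
  element \<open>g\<close> of the large space. The conjugate of \<open>g\<close> lies there too, and
  \<open>diff_op ys\<close> carries it to the conjugate of \<open>f\<close>.\<close>

lemma closed_under_cnj_peel:
  assumes closed: "closed_under_cnj mus" and ms: "mset mus = mset (xs @ ys)"
    and ys: "\<And>f. smooth_fun f \<Longrightarrow> diff_op ys (\<lambda>x. cnj (f x)) = (\<lambda>x. cnj (diff_op ys f x))"
  shows "closed_under_cnj xs"
  unfolding closed_under_cnj_def
proof
  fix f assume f: "f \<in> E_space xs"
  then obtain g where g: "smooth_fun g" "diff_op ys g = f"
    using ex_diff_op_eq E_space_iff by blast
  have "g \<in> E_space (xs @ ys)"
    using f g by (simp add: E_space_iff diff_op_append)
  then have "(\<lambda>x. cnj (g x)) \<in> E_space (xs @ ys)"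
    using closed E_space_mset_cong[OF ms] unfolding closed_under_cnj_def by simp
  then have "diff_op xs (\<lambda>x. cnj (f x)) = (\<lambda>x. 0)"
    using ys[OF g(1)] g(2) by (simp add: E_space_iff diff_op_append)
  then show "(\<lambda>x. cnj (f x)) \<in> E_space xs"
    using f smooth_fun_cnj by (simp add: E_space_iff)
qed

text \<open>The exponential of an eigenvalue lies in the space, hence so does its conjugate; the
  operator multiplies the latter by the characteristic polynomial at \<open>cnj mu\<close>, which
  must therefore vanish.\<close>

lemma closed_under_cnj_imp_cnj_mem:
  assumes "closed_under_cnj mus" "mu \<in> set mus"
  shows "cnj mu \<in> set mus"
proof -
  let ?e = "\<lambda>nu x. exp (nu * complex_of_real x)"
  have "(\<Prod>nu\<leftarrow>mus. mu - nu) = 0"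
    using assms(2) by (auto simp: prod_list_zero_iff)
  then have "?e mu \<in> E_space mus"
    by (simp add: E_space_iff diff_op_exp smooth_fun_exp)
  then have "(\<lambda>x. cnj (?e mu x)) \<in> E_space mus"
    using assms(1) unfolding closed_under_cnj_def by - (erule bspec)
  moreover have "(\<lambda>x. cnj (?e mu x)) = ?e (cnj mu)"
    by (simp add: exp_cnj)
  ultimately have "(\<Prod>nu\<leftarrow>mus. cnj mu - nu) * ?e (cnj mu) 0 = 0"
    unfolding E_space_iff using diff_op_exp[of mus "cnj mu"] by (metis (no_types))
  then show ?thesis by (auto simp: prod_list_zero_iff)
qed

text \<open>Membership of \<open>cnj mu\<close> says nothing about multiplicities. Removing one real
  entry or one conjugate pair keeps the space closed, so recursion on the shorter list matches
  them.\<close>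

lemma closed_under_cnj_imp_conj_sym:
  assumes "closed_under_cnj mus"
  shows "conj_sym mus"
  using assms
proof (induction "length mus" arbitrary: mus rule: less_induct)
  case less
  show ?case
  proof (cases mus)
    case Nil
    then show ?thesis unfolding conj_sym_def using conj_list.Nil by blast
  next
    case (Cons mu rest)
    show ?thesis
    proof (cases "Im mu = 0")
      case True
      then have mu: "mu = complex_of_real (Re mu)" by (simp add: complex_eq_iff)
      have "closed_under_cnj rest"
      proof (rule closed_under_cnj_peel[OF less.prems, where ys = "[mu]"])
        show "diff_op [mu] (\<lambda>x. cnj (f x)) = (\<lambda>x. cnj (diff_op [mu] f x))" if "smooth_fun f" for f
          using diff_op_cnj[OF conj_list.real[OF conj_list.Nil] that, of "Re mu"] mu by simp
      qed (simp add: Cons)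
      then have "conj_sym rest" using less.hyps Cons by simp
      then show ?thesis using conj_sym_Cons_real Cons mu by metis
    next
      case False
      have "cnj mu \<in> set mus"
        using closed_under_cnj_imp_cnj_mem[OF less.prems, of mu] Cons by simp
      moreover have "cnj mu \<noteq> mu" using False by (simp add: complex_eq_iff)
      ultimately have "cnj mu \<in> set rest" using Cons by auto
      then obtain us vs where rest: "rest = us @ cnj mu # vs" by (meson split_list)
      have ms: "mset mus = mset ((us @ vs) @ [mu, cnj mu])" using Cons rest by simp
      have "closed_under_cnj (us @ vs)"
      proof (rule closed_under_cnj_peel[OF less.prems ms])
        show "diff_op [mu, cnj mu] (\<lambda>x. cnj (f x)) = (\<lambda>x. cnj (diff_op [mu, cnj mu] f x))"
          if "smooth_fun f" for f
          using diff_op_cnj[OF conj_list.pair[OF conj_list.Nil False] that] by simp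
      qed
      then have "conj_sym (us @ vs)" using less.hyps[of "us @ vs"] Cons rest by simp
      then obtain xs where "conj_list xs" "mset xs = mset (us @ vs)"
        unfolding conj_sym_def by blast
      then show ?thesis
        unfolding conj_sym_def using conj_list.pair[OF _ False] ms
        by (intro exI[of _ "xs @ [mu, cnj mu]"]) simp
    qed
  qed
qed

section \<open>The Chebyshev property\<close>

text \<open>Tracking vanishing of the iterated first-order operators at the endpoints, instead of vanishing
  of higher derivatives, means that the weights $h$ need only be differentiable on $[a,b]$.\<close>

inductive rolle_chain :: "real \<Rightarrow> real \<Rightarrow> nat \<Rightarrow> nat \<Rightarrow> nat \<Rightarrow> (real \<Rightarrow> real) \<Rightarrow> bool"
  for a b :: real where
  zero: "(\<And>x. x \<in> {a..b} \<Longrightarrow> f x = 0) \<Longrightarrow> rolle_chain a b 0 \<alpha> \<beta> f"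
| step: "\<lbrakk>\<And>x. x \<in> {a..b} \<Longrightarrow> (f has_real_derivative f' x) (at x);
    \<And>x. x \<in> {a..b} \<Longrightarrow> (h has_real_derivative g x * h x) (at x);
    \<And>x. x \<in> {a..b} \<Longrightarrow> h x > 0;
    \<alpha> > 0 \<Longrightarrow> f a = 0; \<beta> > 0 \<Longrightarrow> f b = 0;
    rolle_chain a b n (\<alpha> - 1) (\<beta> - 1) (\<lambda>x. f' x - g x * f x)\<rbrakk>
    \<Longrightarrow> rolle_chain a b (Suc n) \<alpha> \<beta> f"

text \<open>The new zeros lie strictly between the extreme old ones, hence off the endpoints, so
  endpoint conditions can be counted afresh at the next stage.\<close>

lemma rolle_card:
  fixes u u' :: "real \<Rightarrow> real"
  assumes "finite T" "card T = Suc m" "\<And>x. x \<in> T \<Longrightarrow> u x = 0"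
    and "\<And>x. x \<in> {Min T..Max T} \<Longrightarrow> (u has_real_derivative u' x) (at x)"
  shows "\<exists>S. finite S \<and> card S = m \<and> S \<subseteq> {Min T<..<Max T} \<and> (\<forall>x\<in>S. u' x = 0)"
  using assms
proof (induction m arbitrary: T)
  case 0
  then show ?case by (intro exI[of _ "{}"]) auto
next
  case (Suc m)
  define T' where "T' = T - {Max T}"
  have T: "T \<noteq> {}" using Suc.prems by auto
  have MT: "Max T \<in> T" using T Suc.prems by simp
  have T': "finite T'" "card T' = Suc m" "T' \<subseteq> T"
    using Suc.prems MT by (auto simp: T'_def)
  then have T'ne: "T' \<noteq> {}" by auto
  have mm: "Min T \<le> Min T'" "Max T' < Max T"
  proof -
    show "Min T \<le> Min T'" using T' T'ne Suc.prems(1) by (intro Min_antimono) auto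
    have "Max T' \<in> T'" using T' T'ne by simp
    then show "Max T' < Max T" using Suc.prems(1) Max_ge[OF Suc.prems(1)]
      by (metis DiffE T'_def insertI1 order_le_less)
  qed
  obtain S where S: "finite S" "card S = m" "S \<subseteq> {Min T'<..<Max T'}" "\<forall>x\<in>S. u' x = 0"
    using Suc.IH[OF T'(1,2)] Suc.prems T' mm by fastforce
  have sub: "{Max T'..Max T} \<subseteq> {Min T..Max T}"
    using mm T' T'ne by (auto intro: order_trans[OF Min_le] Max_in)
  have "\<exists>z. Max T' < z \<and> z < Max T \<and> u' z = 0"
  proof -
    have mem: "Max T' \<in> T" "Max T \<in> T" using MT T' T'ne Max_in by blast+
    then have eq: "u (Max T') = u (Max T)" using Suc.prems(3) by simp
    have D: "(u has_real_derivative u' x) (at x)" if "x \<in> {Max T'..Max T}" for x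
      using that sub Suc.prems(4) by blast
    have "\<exists>z>Max T'. z < Max T \<and> (\<lambda>v. u' z * v) = (\<lambda>v. 0)"
    proof (rule Rolle_deriv[OF mm(2) eq])
      show "continuous_on {Max T'..Max T} u"
        using D by (meson DERIV_isCont continuous_at_imp_continuous_on)
      show "(u has_derivative (\<lambda>v. u' x * v)) (at x)" if "Max T' < x" "x < Max T" for x
        using D[of x] that by (simp add: has_field_derivative_def)
    qed
    then show ?thesis by (metis mult.right_neutral)
  qed
  then obtain z where z: "Max T' < z" "z < Max T" "u' z = 0" by blast
  have "Min T \<le> Max T'" using sub mm by auto
  with S z mm show ?case
    by (intro exI[of _ "insert z S"]) (fastforce simp: card_insert_if)
qed

text \<open>Each stage lowers the order and the number of zeros by one each: an endpoint with
  remaining multiplicity contributes one zero to \<open>T\<close> and loses one order, and Rolle's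
  theorem costs one zero in total.\<close>

lemma rolle_chain_eq_0:
  assumes "rolle_chain a b n \<alpha> \<beta> f" "a < b"
    and "finite S" "S \<subseteq> {a<..<b}" "\<And>x. x \<in> S \<Longrightarrow> f x = 0" "n \<le> \<alpha> + \<beta> + card S"
  shows "\<forall>x\<in>{a..b}. f x = 0"
  using assms
proof (induction arbitrary: S rule: rolle_chain.induct)
  case (step f f' h g \<alpha> \<beta> n)
  define T where "T = S \<union> (if \<alpha> > 0 then {a} else {}) \<union> (if \<beta> > 0 then {b} else {})"
  have T: "finite T" "T \<subseteq> {a..b}" "\<And>x. x \<in> T \<Longrightarrow> f x = 0"
    using step.hyps(4,5) step.prems(1-4) by (auto simp: T_def split: if_splits)
  have aS: "a \<notin> S" "b \<notin> S" "a \<noteq> b" using step.prems by auto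
  have cT: "card T = card S + (if \<alpha> > 0 then 1 else 0) + (if \<beta> > 0 then 1 else 0)"
    using aS step.prems(2) by (auto simp: T_def)
  then have "card T > 0" using step.prems by (auto split: if_splits)
  then obtain m where m: "card T = Suc m" using gr0_conv_Suc by blast
  then have ne: "T \<noteq> {}" by auto
  have TT: "a \<le> Min T" "Max T \<le> b" using T ne by (meson Min_in Max_in atLeastAtMost_iff subsetD)+
  \<comment> \<open>Dividing by the weight turns the first-order operator into a plain derivative,
    up to the positive factor \<open>1 / h\<close>.\<close>
  let ?u = "\<lambda>x. f x / h x" and ?u' = "\<lambda>x. (f' x - g x * f x) / h x"
  have D: "(?u has_real_derivative ?u' x) (at x)" if "x \<in> {a..b}" for x
  proof -
    have h: "h x \<noteq> 0" using step.hyps(3)[OF that] by simp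
    then have "(f' x * h x - f x * (g x * h x)) / (h x * h x) = ?u' x"
      by (simp add: field_simps)
    then show ?thesis
      using DERIV_divide[OF step.hyps(1)[OF that] step.hyps(2)[OF that] h] by metis
  qed
  have "\<exists>S. finite S \<and> card S = m \<and> S \<subseteq> {Min T<..<Max T} \<and> (\<forall>x\<in>S. ?u' x = 0)"
    using T TT D by (intro rolle_card[of T m ?u ?u'] m) auto
  then obtain S' where S': "finite S'" "card S' = m" "S' \<subseteq> {Min T<..<Max T}" "\<forall>x\<in>S'. ?u' x = 0"
    by blast
  have S'ab: "S' \<subseteq> {a<..<b}" using S'(3) TT by fastforce
  have "\<forall>x\<in>{a..b}. f' x - g x * f x = 0"
  proof (rule step.IH[OF step.prems(1) S'(1) S'ab])
    show "f' x - g x * f x = 0" if "x \<in> S'" for x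
    proof -
      have "x \<in> {a..b}" using that S'ab by auto
      then have "h x > 0" using step.hyps(3) by blast
      then show ?thesis using S'(4) that by fastforce
    qed
    show "n \<le> \<alpha> - 1 + (\<beta> - 1) + card S'"
      using cT m S'(2) step.prems(5) by (auto split: if_splits)
  qed
  \<comment> \<open>So \<open>f / h\<close> is constant on \<open>[a, b]\<close>, and any point of
    the nonempty set \<open>T\<close> shows that the constant is 0.\<close>
  then have D0: "(?u has_real_derivative 0) (at x within {a..b})" if "x \<in> {a..b}" for x
    using D[OF that] that by (auto intro: has_field_derivative_at_within)
  obtain t where t: "t \<in> T" using ne by blast
  have "?u x = ?u t" if "x \<in> {a..b}" for x
    using has_field_derivative_zero_constant[of "{a..b}" ?u] D0 that t T(2)
    by (metis convex_real_interval(5) subsetD)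
  then have "?u x = 0" if "x \<in> {a..b}" for x using that t T(3) by simp
  then show ?case using step.hyps(3) by fastforce
qed auto

text \<open>Stated eigenvalue by eigenvalue, so that it passes to sublists and is unaffected by
  adjoining real eigenvalues.\<close>

definition narrow :: "real \<Rightarrow> real \<Rightarrow> complex list \<Rightarrow> bool" where
  "narrow a b mus \<longleftrightarrow> (\<forall>mu\<in>set mus. Im mu \<noteq> 0 \<longrightarrow> b - a < pi / \<bar>Im mu\<bar>)"

text \<open>Order at least \<open>k\<close>: the half of \<open>zero_order\<close> that survives
  linear combinations.\<close>

definition vanishes :: "(real \<Rightarrow> complex) \<Rightarrow> real \<Rightarrow> nat \<Rightarrow> bool" where
  "vanishes f c k \<longleftrightarrow> (\<forall>j<k. vderiv j f c = 0)"

lemma vanishes_dstep: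
  assumes "smooth_fun f" "vanishes f c k"
  shows "vanishes (dstep mu f) c (k - 1)"
  using assms by (simp add: vanishes_def vderiv_dstep del: vderiv.simps)

lemma vanishes_imp_zero: "vanishes f c k \<Longrightarrow> k > 0 \<Longrightarrow> f c = 0"
  unfolding vanishes_def by (metis vderiv.simps(1))

lemma Re_has_derivative:
  assumes "smooth_fun f"
  shows "((\<lambda>x. Re (f x)) has_real_derivative Re (vderiv 1 f x)) (at x)"
  using bounded_linear.has_vector_derivative[OF bounded_linear_Re smooth_fun_has_deriv[OF assms]]
  by (simp add: has_real_derivative_iff_has_vector_derivative)

text \<open>The real second-order operator $(D-\alpha)^2+\beta^2$ factors as $(D-2\alpha+g)(D-g)$ with
  $g = h'/h$ for any solution $h$; the solution $e^{\alpha x}\sin(\beta(x-c))$ has no zero on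
  $[a,b]$ for a suitable $c<a$ precisely because $b-a<\pi/\beta$.\<close>

lemma rolle_chain_pair:
  assumes f: "smooth_fun f" and ab: "a < b" and mu: "Im mu \<noteq> 0" "b - a < pi / \<bar>Im mu\<bar>"
    and van: "vanishes f a \<alpha>" "vanishes f b \<beta>"
    and chain: "rolle_chain a b n (\<alpha> - 1 - 1) (\<beta> - 1 - 1) (\<lambda>x. Re (diff_op [mu, cnj mu] f x))"
  shows "rolle_chain a b (Suc (Suc n)) \<alpha> \<beta> (\<lambda>x. Re (f x))"
proof -
  define r where "r = Re mu"
  define s where "s = \<bar>Im mu\<bar>"
  have s: "s > 0" using mu by (simp add: s_def)
  define w where "w = pi / s"
  \<comment> \<open>This centres the interval \<open>(c, c + w)\<close> on \<open>[a, b]\<close>, so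
    that \<theta> maps \<open>[a, b]\<close> into the open interval from 0 to pi.\<close>
  define c where "c = a - (w - (b - a)) / 2"
  define \<theta> where "\<theta> = (\<lambda>x. s * (x - c))"
  have th: "0 < \<theta> x \<and> \<theta> x < pi" if "x \<in> {a..b}" for x
  proof -
    have "b - a < w" using mu(2) by (simp add: s_def w_def)
    then have "0 < x - c" "x - c < w"
      using that by (auto simp: c_def field_simps)
    then show ?thesis using s by (simp add: \<theta>_def w_def field_simps)
  qed
  have sin: "sin (\<theta> x) > 0" if "x \<in> {a..b}" for x
    using th[OF that] sin_gt_zero by blast
  define g where "g = (\<lambda>x. r + s * cos (\<theta> x) / sin (\<theta> x))"
  define h1 where "h1 = (\<lambda>x. exp (r * x) * sin (\<theta> x))"
  \<comment> \<open>The logarithmic derivatives of the two weights must add up to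
    \<open>2 * r\<close>, that is, \<open>h1 * h2\<close> is exp(2 r x).\<close>
  define h2 where "h2 = (\<lambda>x. exp (r * x) / sin (\<theta> x))"
  let ?u = "\<lambda>x. Re (f x)" and ?u1 = "\<lambda>x. Re (vderiv 1 f x)" and ?u2 = "\<lambda>x. Re (vderiv 2 f x)"
  have u1: "(?u has_real_derivative ?u1 x) (at x)" for x
    by (rule Re_has_derivative[OF f])
  have u2: "(?u1 has_real_derivative ?u2 x) (at x)" for x
    using Re_has_derivative[OF smooth_fun_vderiv[OF f], of x] by (simp add: numeral_2_eq_2)
  have h1': "(h1 has_real_derivative g x * h1 x) (at x)" if "x \<in> {a..b}" for x
    using sin[OF that] unfolding h1_def g_def \<theta>_def
    by (auto intro!: derivative_eq_intros simp: field_simps)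
  have h2': "(h2 has_real_derivative (2 * r - g x) * h2 x) (at x)" if "x \<in> {a..b}" for x
    using sin[OF that] unfolding h2_def g_def \<theta>_def
    by (auto intro!: derivative_eq_intros simp: field_simps)
  \<comment> \<open>The Riccati equation for \<open>g\<close>; it makes the zeroth-order coefficient
    of the composed factors the constant \<open>r\<^sup>2 + s\<^sup>2\<close>.\<close>
  have g': "(g has_real_derivative - s\<^sup>2 - (g x - r)\<^sup>2) (at x)" if "x \<in> {a..b}" for x
  proof -
    have "(g has_real_derivative s * ((- sin (\<theta> x) * s) * sin (\<theta> x) - cos (\<theta> x) * (cos (\<theta> x) * s))
        / (sin (\<theta> x) * sin (\<theta> x))) (at x)"
      using sin[OF that] unfolding g_def \<theta>_def
      by (auto intro!: derivative_eq_intros simp: field_simps)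
    moreover have "s * ((- sin (\<theta> x) * s) * sin (\<theta> x) - cos (\<theta> x) * (cos (\<theta> x) * s))
        / (sin (\<theta> x) * sin (\<theta> x)) = - s\<^sup>2 - (g x - r)\<^sup>2"
      using sin[OF that] by (simp add: g_def field_simps power2_eq_square)
    ultimately show ?thesis by simp
  qed
  let ?v = "\<lambda>x. ?u1 x - g x * ?u x"
  let ?v' = "\<lambda>x. ?u2 x - ((- s\<^sup>2 - (g x - r)\<^sup>2) * ?u x + g x * ?u1 x)"
  have v': "(?v has_real_derivative ?v' x) (at x)" if "x \<in> {a..b}" for x
    using DERIV_diff[OF u2 DERIV_mult[OF g'[OF that] u1]] by (simp add: algebra_simps)
  have van1: "vderiv 1 f a = 0" if "\<alpha> - 1 > 0" using van(1) that unfolding vanishes_def by (simp only: zero_less_diff)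
  have van2: "vderiv 1 f b = 0" if "\<beta> - 1 > 0" using van(2) that unfolding vanishes_def by (simp only: zero_less_diff)
  have key: "?v' x - (2 * r - g x) * ?v x = Re (diff_op [mu, cnj mu] f x)" for x
  proof -
    have "diff_op [mu, cnj mu] f x = vderiv 1 (dstep (cnj mu) f) x - mu * dstep (cnj mu) f x"
      unfolding diff_op_Cons' by (simp add: dstep_def)
    also have "\<dots> = vderiv 2 f x - cnj mu * vderiv 1 f x - mu * (vderiv 1 f x - cnj mu * f x)"
      unfolding vderiv_dstep[OF f] by (simp add: dstep_def numeral_2_eq_2)
    also have "\<dots> = vderiv 2 f x - of_real (2 * r) * vderiv 1 f x + of_real (r\<^sup>2 + s\<^sup>2) * f x"
      by (auto simp: complex_eq_iff r_def s_def algebra_simps power2_eq_square)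
    finally have eq: "diff_op [mu, cnj mu] f x
        = vderiv 2 f x - of_real (2 * r) * vderiv 1 f x + of_real (r\<^sup>2 + s\<^sup>2) * f x" .
    show ?thesis
      unfolding eq by (simp add: algebra_simps power2_eq_square del: vderiv.simps)
  qed
  show ?thesis
  proof (rule rolle_chain.step[OF u1 h1'])
    show "h1 x > 0" if "x \<in> {a..b}" for x using sin[OF that] by (simp add: h1_def)
    show "Re (f a) = 0" if "\<alpha> > 0" using vanishes_imp_zero[OF van(1) that] by simp
    show "Re (f b) = 0" if "\<beta> > 0" using vanishes_imp_zero[OF van(2) that] by simp
    show "rolle_chain a b (Suc n) (\<alpha> - 1) (\<beta> - 1) ?v"
    proof (rule rolle_chain.step[OF v' h2'])
      show "h2 x > 0" if "x \<in> {a..b}" for x using sin[OF that] by (simp add: h2_def)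
      show "?v a = 0" if "\<alpha> - 1 > 0" using vanishes_imp_zero[OF van(1)] van1 that by simp
      show "?v b = 0" if "\<beta> - 1 > 0" using vanishes_imp_zero[OF van(2)] van2 that by simp
      show "rolle_chain a b n (\<alpha> - 1 - 1) (\<beta> - 1 - 1) (\<lambda>x. ?v' x - (2 * r - g x) * ?v x)"
        using chain unfolding key .
    qed
  qed
qed

text \<open>The operators of a real entry and of a conjugate pair have real coefficients and so
  commute with real parts. A real entry costs one order of vanishing at each endpoint, a pair
  two.\<close>

lemma rolle_chain_Re:
  assumes "conj_list mus" "a < b" "narrow a b mus" "f \<in> E_space mus"
    and "vanishes f a \<alpha>" "vanishes f b \<beta>"
  shows "rolle_chain a b (length mus) \<alpha> \<beta> (\<lambda>x. Re (f x))"
  using assms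
proof (induction arbitrary: f \<alpha> \<beta> rule: conj_list.induct)
  case Nil
  then show ?case by (auto simp: E_space_def intro: rolle_chain.zero)
next
  case (real xs r)
  have f: "smooth_fun f" using real.prems by (simp add: E_space_iff)
  have "dstep (of_real r) f \<in> E_space xs"
    using real.prems smooth_fun_dstep[OF f] by (simp add: E_space_iff diff_op_append diff_op_single del: diff_op.simps(2))
  then have "rolle_chain a b (length xs) (\<alpha> - 1) (\<beta> - 1) (\<lambda>x. Re (dstep (of_real r) f x))"
    using real.prems by (intro real.IH vanishes_dstep f) (auto simp: narrow_def)
  then have "rolle_chain a b (Suc (length xs)) \<alpha> \<beta> (\<lambda>x. Re (f x))"
    using vanishes_imp_zero[OF real.prems(4)] vanishes_imp_zero[OF real.prems(5)]
    by (intro rolle_chain.step[where f' = "\<lambda>x. Re (vderiv 1 f x)" and g = "\<lambda>x. r"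
          and h = "\<lambda>x. exp (r * x)"] Re_has_derivative[OF f])
      (auto simp: dstep_def intro!: derivative_eq_intros)
  then show ?case by simp
next
  case (pair xs mu)
  have f: "smooth_fun f" using pair.prems by (simp add: E_space_iff)
  have "diff_op [mu, cnj mu] f \<in> E_space xs"
    using pair.prems smooth_fun_diff_op[OF f] by (simp add: E_space_iff diff_op_append del: diff_op.simps(2))
  moreover have "vanishes (diff_op [mu, cnj mu] f) c (k - 1 - 1)" if "vanishes f c k" for c k
    unfolding diff_op_Cons' diff_op.simps(1)
    by (intro vanishes_dstep smooth_fun_dstep f that)
  ultimately have "rolle_chain a b (length xs) (\<alpha> - 1 - 1) (\<beta> - 1 - 1) (\<lambda>x. Re (diff_op [mu, cnj mu] f x))"
    using pair.prems by (intro pair.IH) (auto simp: narrow_def)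
  then have "rolle_chain a b (Suc (Suc (length xs))) \<alpha> \<beta> (\<lambda>x. Re (f x))"
    using pair.prems pair.hyps by (intro rolle_chain_pair[OF f]) (auto simp: narrow_def)
  then show ?case by simp
qed

section \<open>From vanishing on an interval to vanishing on the whole line\<close>

lemma diff_op_eq_0_if_locally_0:
  assumes "open U" "\<And>x. x \<in> U \<Longrightarrow> f x = 0" "x \<in> U"
  shows "diff_op mus f x = 0"
  using assms(3)
proof (induction mus arbitrary: x)
  case (Cons mu mus)
  have "(diff_op mus f has_vector_derivative 0) (at x)"
    by (rule has_vector_derivative_transform_within_open[OF has_vector_derivative_const[of 0] assms(1)])
      (simp_all add: Cons)
  then have "vector_derivative (diff_op mus f) (at x) = 0" by (rule vector_derivative_at)
  then show ?case using Cons by simp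
qed (use assms in simp)

text \<open>The image under the inner factors solves a homogeneous first-order equation and is 0 at
  \<open>c\<close>, hence everywhere; so \<open>f\<close> already lies in the space with one
  eigenvalue fewer.\<close>

lemma E_space_eq_0_if_locally_0:
  assumes "f \<in> E_space mus" "open U" "c \<in> U" "\<And>x. x \<in> U \<Longrightarrow> f x = 0"
  shows "f = (\<lambda>x. 0)"
  using assms(1)
proof (induction mus)
  case Nil
  then show ?case by (simp add: E_space_iff)
next
  case (Cons mu mus)
  then have f: "smooth_fun f" "dstep mu (diff_op mus f) = (\<lambda>x. 0)"
    unfolding E_space_iff diff_op_Cons' by auto
  have "diff_op mus f x = 0" for x
    using dstep_eq_0_imp_exp[OF smooth_fun_diff_op[OF f(1)] f(2), of x c]
      diff_op_eq_0_if_locally_0[where mus = mus, OF assms(2,4,3)] by simp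
  then show ?case using Cons.IH f(1) by (auto simp: E_space_iff)
qed

theorem E_space_chebyshev:
  assumes "conj_sym mus" "a < b" "narrow a b mus" "f \<in> E_space mus"
    and "vanishes f a \<alpha>" "vanishes f b \<beta>"
    and "finite S" "S \<subseteq> {a<..<b}" "\<And>x. x \<in> S \<Longrightarrow> f x = 0" "length mus \<le> \<alpha> + \<beta> + card S"
  shows "f = (\<lambda>x. 0)"
proof -
  obtain xs where xs: "conj_list xs" "mset xs = mset mus"
    using assms(1) unfolding conj_sym_def by blast
  have nar: "narrow a b xs" and len: "length xs = length mus"
    using assms(3) xs(2) by (auto simp: narrow_def dest: mset_eq_setD mset_eq_length)
  \<comment> \<open>The space is complex, so multiples may be taken: \<open>c = 1\<close> yields the
    real part and \<open>c = -i\<close> the imaginary part.\<close>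
  have Re0: "\<forall>x\<in>{a..b}. Re (c * f x) = 0" for c
  proof (rule rolle_chain_eq_0[OF rolle_chain_Re[OF xs(1) assms(2) nar]])
    have f: "smooth_fun f" using assms(4) by (simp add: E_space_iff)
    show "(\<lambda>x. c * f x) \<in> E_space xs"
      using assms(4) E_space_mset_cong[OF xs(2)] E_space_cmult by blast
    show "vanishes (\<lambda>x. c * f x) a \<alpha>" "vanishes (\<lambda>x. c * f x) b \<beta>"
      using assms(5,6) by (auto simp: vanishes_def vderiv_cmult[OF f])
  qed (use assms len in auto)
  have "f x = 0" if "x \<in> {a<..<b}" for x
    using Re0[of 1] Re0[of "- \<i>"] that by (auto simp: complex_eq_iff)
  then show ?thesis
    using E_space_eq_0_if_locally_0[OF assms(4), of "{a<..<b}" "(a + b) / 2"] assms(2) by auto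
qed

section \<open>The Bernstein basis\<close>

text \<open>Restricted to smooth functions because \<open>vector_derivative\<close> is an arbitrary
  value where no derivative exists.\<close>

definition linear_on_smooth :: "((real \<Rightarrow> complex) \<Rightarrow> complex) \<Rightarrow> bool" where
  "linear_on_smooth l \<longleftrightarrow> (\<forall>f g c d. smooth_fun f \<longrightarrow> smooth_fun g \<longrightarrow>
    l (\<lambda>x. c * f x + d * g x) = c * l f + d * l g)"

lemma linear_on_smoothD:
  "linear_on_smooth l \<Longrightarrow> smooth_fun f \<Longrightarrow> smooth_fun g \<Longrightarrow>
    l (\<lambda>x. c * f x + d * g x) = c * l f + d * l g"
  by (simp add: linear_on_smooth_def)

lemma linear_on_smooth_vderiv: "linear_on_smooth (\<lambda>f. vderiv j f c)"
  by (simp add: linear_on_smooth_def vderiv_lincomb)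

text \<open>This is the only consequence of $\dim E_{mus} = |mus|$ that is needed.\<close>

lemma E_space_common_kernel:
  assumes "finite L" "card L < length mus" "\<And>l. l \<in> L \<Longrightarrow> linear_on_smooth l"
  shows "\<exists>f\<in>E_space mus. f \<noteq> (\<lambda>x. 0) \<and> (\<forall>l\<in>L. l f = 0)"
  using assms
proof (induction mus arbitrary: L)
  case (Cons mu mus)
  let ?exp = "\<lambda>x. exp (mu * complex_of_real x)"
  \<comment> \<open>\<open>e\<close> spans the extra dimension: \<open>diff_op mus\<close> maps it
    to a nonzero function that the factor of \<open>mu\<close> annihilates.\<close>
  obtain e where e: "smooth_fun e" "diff_op mus e = ?exp"
    using ex_diff_op_eq smooth_fun_exp by blast
  have eE: "e \<in> E_space (mu # mus)"
    using e dstep_exp[of mu 1 mu] unfolding E_space_iff diff_op_Cons' by simp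
  have comb_ne: "c = 0" if "f \<in> E_space mus" "(\<lambda>x. 1 * f x + c * e x) = (\<lambda>x. 0)" for c f
  proof -
    have "diff_op mus (\<lambda>x. 1 * f x + c * e x) 0 = 0"
      unfolding that(2) by (simp add: diff_op_zero)
    moreover have "diff_op mus (\<lambda>x. 1 * f x + c * e x) 0 = c"
      using that(1) e diff_op_lincomb[of f e mus 1 c] by (simp add: E_space_iff)
    ultimately show ?thesis by simp
  qed
  show ?case
  proof (cases "\<forall>l\<in>L. l e = 0")
    case True
    have "e \<noteq> (\<lambda>x. 0)" using e(2) diff_op_zero[of mus] by (metis exp_not_eq_zero)
    with True eE show ?thesis by blast
  next
    case False
    then obtain l1 where l1: "l1 \<in> L" "l1 e \<noteq> 0" by blast
    \<comment> \<open>\<open>proj f\<close> corrects \<open>f\<close> by a multiple of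
      \<open>e\<close> so that \<open>l1\<close> kills it, and on smooth functions
      \<open>red l\<close> is \<open>l\<close> after \<open>proj\<close>. A common zero of the
      reduced functionals in the smaller space thus projects to one of all of
      \<open>L\<close>.\<close>
    define proj where "proj = (\<lambda>f x. 1 * f x + (- l1 f / l1 e) * e x)"
    define red where "red = (\<lambda>(l :: (real \<Rightarrow> complex) \<Rightarrow> complex) f. l f - l1 f / l1 e * l e)"
    define L' where "L' = red ` (L - {l1})"
    have lin: "linear_on_smooth l" if "l \<in> L" for l using Cons.prems that by blast
    have proj: "l (proj f) = l f - l1 f / l1 e * l e" if "l \<in> L" "smooth_fun f" for l f
      unfolding proj_def linear_on_smoothD[OF lin[OF that(1)] that(2) e(1)] by simp
    have "card L' \<le> card (L - {l1})"
      unfolding L'_def using Cons.prems(1) by (intro card_image_le) simp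
    then have card: "card L' < length mus"
      using Cons.prems(1,2) l1(1) card_gt_0_iff[of L] by (auto simp: card_Diff_singleton)
    have "linear_on_smooth l" if mem: "l \<in> L'" for l
    proof -
      obtain l0 where l0: "l0 \<in> L" "l = red l0"
        using mem unfolding L'_def by blast
      then show ?thesis
        unfolding linear_on_smooth_def
        by (simp add: red_def linear_on_smoothD[OF lin[OF l0(1)]] linear_on_smoothD[OF lin[OF l1(1)]]
            algebra_simps add_divide_distrib)
    qed
    then obtain f where f: "f \<in> E_space mus" "f \<noteq> (\<lambda>x. 0)" "\<forall>l\<in>L'. l f = 0"
      using Cons.IH[OF _ card] Cons.prems(1) unfolding L'_def by auto
    have fs: "smooth_fun f" using f(1) by (simp add: E_space_iff)
    have "proj f \<in> E_space (mu # mus)"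
      unfolding proj_def by (intro E_space_lincomb eE E_space_Cons_subset f)
    moreover have "proj f \<noteq> (\<lambda>x. 0)"
    proof
      assume 0: "proj f = (\<lambda>x. 0)"
      then have "- l1 f / l1 e = 0" using comb_ne[OF f(1)] unfolding proj_def by blast
      then have "proj f = f" by (auto simp: proj_def)
      with 0 f(2) show False by simp
    qed
    moreover have "l (proj f) = 0" if "l \<in> L" for l
    proof (cases "l = l1")
      case True
      then show ?thesis using proj[OF that fs] l1 by simp
    next
      case False
      then have "red l \<in> L'" using that unfolding L'_def by blast
      then have "red l f = 0" using f(3) by blast
      then show ?thesis using proj[OF that fs] by (simp add: red_def)
    qed
    ultimately show ?thesis by blast
  qed
qed simp

definition is_bernstein :: "real \<Rightarrow> real \<Rightarrow> complex list \<Rightarrow> nat \<Rightarrow> (real \<Rightarrow> complex) \<Rightarrow> bool" where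
  "is_bernstein a b mus k p \<longleftrightarrow> p \<in> E_space mus \<and> zero_order p a k
      \<and> zero_order p b (length mus - 1 - k) \<and> vderiv k p a = 1"

lemma zero_order_iff: "zero_order f c k \<longleftrightarrow> vanishes f c k \<and> vderiv k f c \<noteq> 0"
  by (simp add: zero_order_def vanishes_def)

lemma vanishes_Suc: "vanishes f c (Suc k) \<longleftrightarrow> vanishes f c k \<and> vderiv k f c = 0"
  by (auto simp: vanishes_def less_Suc_eq)

lemma vanishes_lincomb:
  "smooth_fun f \<Longrightarrow> smooth_fun g \<Longrightarrow> vanishes f e k \<Longrightarrow> vanishes g e k \<Longrightarrow>
    vanishes (\<lambda>x. c * f x + d * g x) e k"
  by (auto simp: vanishes_def vderiv_lincomb)

lemma vanishes_diff:
  "smooth_fun f \<Longrightarrow> smooth_fun g \<Longrightarrow> vanishes f e k \<Longrightarrow> vanishes g e k \<Longrightarrow>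
    vanishes (\<lambda>x. f x - g x) e k"
  using vanishes_lincomb[of f g e k 1 "-1"] by simp

lemma is_bernstein_unique:
  assumes "conj_sym mus" "a < b" "narrow a b mus" "k < length mus"
    and "is_bernstein a b mus k p" "is_bernstein a b mus k q"
  shows "p = q"
proof -
  note pq = assms(5,6)[unfolded is_bernstein_def zero_order_iff]
  have s: "smooth_fun p" "smooth_fun q" using pq by (auto simp: E_space_iff)
  have "(\<lambda>x. p x - q x) = (\<lambda>x. 0)"
  proof (rule E_space_chebyshev[OF assms(1-3), where S = "{}"])
    \<comment> \<open>The common normalisation at \<open>a\<close> supplies the extra order that
      brings the count up to \<open>length mus\<close>.\<close>
    show "vanishes (\<lambda>x. p x - q x) a (Suc k)"
      using pq vanishes_diff[OF s] by (simp add: vanishes_Suc vderiv_diff[OF s])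
    show "vanishes (\<lambda>x. p x - q x) b (length mus - 1 - k)"
      using pq vanishes_diff[OF s] by blast
  qed (use pq E_space_diff assms(4) in auto)
  then show ?thesis by (auto simp: fun_eq_iff)
qed

text \<open>The prescribed zeros amount to \<open>length mus - 1\<close> linear conditions, so some
  nonzero element meets them. One more order at either endpoint would force it to vanish, so both
  orders are exact and it can be normalised.\<close>

lemma ex_is_bernstein:
  assumes "conj_sym mus" "a < b" "narrow a b mus" "k < length mus"
  shows "\<exists>p. is_bernstein a b mus k p"
proof -
  define m where "m = length mus - 1 - k"
  let ?A = "(\<lambda>j f. vderiv j f a) ` {..<k}" and ?B = "(\<lambda>j f. vderiv j f b) ` {..<m}"
  have "card (?A \<union> ?B) \<le> card ?A + card ?B" by (rule card_Un_le)
  also have "\<dots> \<le> k + m"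
    using card_image_le[of "{..<k}"] card_image_le[of "{..<m}"] by (metis add_mono card_lessThan finite_lessThan)
  also have "\<dots> < length mus" using assms(4) by (simp add: m_def)
  finally obtain f where f: "f \<in> E_space mus" "f \<noteq> (\<lambda>x. 0)" "\<forall>l\<in>?A \<union> ?B. l f = 0"
    using E_space_common_kernel[of "?A \<union> ?B" mus] linear_on_smooth_vderiv by blast
  have fs: "smooth_fun f" using f(1) by (simp add: E_space_iff)
  have van: "vanishes f a k" "vanishes f b m"
    using f(3) by (auto simp: vanishes_def)
  have km: "k + m + 1 = length mus" using assms(4) by (simp add: m_def)
  have na: "vderiv k f a \<noteq> 0"
    using E_space_chebyshev[OF assms(1-3) f(1), of "Suc k" m "{}"] van f(2) km
    by (auto simp: vanishes_Suc)
  have nb: "vderiv m f b \<noteq> 0"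
    using E_space_chebyshev[OF assms(1-3) f(1), of k "Suc m" "{}"] van f(2) km
    by (auto simp: vanishes_Suc)
  have "is_bernstein a b mus k (\<lambda>x. inverse (vderiv k f a) * f x)"
    unfolding is_bernstein_def m_def[symmetric]
    using van na nb E_space_cmult[OF f(1)]
    by (simp add: zero_order_def vanishes_def vderiv_cmult[OF fs])
  then show ?thesis by blast
qed

lemma is_bernstein_bernstein:
  assumes "conj_sym mus" "a < b" "narrow a b mus" "k < length mus"
  shows "is_bernstein a b mus k (bernstein a b mus k)"
proof -
  have "\<exists>!p. is_bernstein a b mus k p"
    using ex_is_bernstein[OF assms] is_bernstein_unique[OF assms] by blast
  then show ?thesis
    unfolding bernstein_def is_bernstein_def by (rule theI')
qed

text \<open>The conjugate of \<open>p\<close> meets the same conditions, so uniqueness identifies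
  the two.\<close>

lemma bernstein_real:
  assumes "conj_sym mus" "a < b" "narrow a b mus" "k < length mus" "is_bernstein a b mus k p"
  shows "p x = complex_of_real (Re (p x))"
proof -
  have s: "smooth_fun p" using assms(5) by (simp add: is_bernstein_def E_space_iff)
  have "is_bernstein a b mus k (\<lambda>x. cnj (p x))"
    using assms(5) E_space_cnj[OF assms(1)]
    by (simp add: is_bernstein_def zero_order_def vderiv_cnj[OF s])
  then have "(\<lambda>x. cnj (p x)) = p" using is_bernstein_unique[OF assms(1-4)] assms(5) by blast
  then have "cnj (p x) = p x" by (rule fun_cong)
  then show ?thesis by (simp add: complex_eq_iff)
qed

text \<open>The leading Taylor coefficient, obtained by repeated use of L'Hopital's rule.\<close>

lemma Re_quotient_power_tendsto:
  assumes "smooth_fun f" "vanishes f c k"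
  shows "((\<lambda>x. Re (f x) / (x - c) ^ k) \<longlongrightarrow> Re (vderiv k f c) / fact k) (at c)"
  using assms
proof (induction k arbitrary: f)
  case 0
  have "isCont (\<lambda>x. Re (f x)) c"
    using Re_has_derivative[OF 0(1)] DERIV_isCont by blast
  then show ?case by (simp add: isCont_def)
next
  case (Suc k)
  have van': "vanishes (vderiv 1 f) c k"
    using Suc.prems(2) unfolding vanishes_def vderiv_Suc'[symmetric] by blast
  have "isCont (\<lambda>x. Re (f x)) c"
    using Re_has_derivative[OF Suc.prems(1)] DERIV_isCont by blast
  then have lim0: "((\<lambda>x. Re (f x)) \<longlongrightarrow> 0) (at c)"
    using vanishes_imp_zero[OF Suc.prems(2)] by (simp add: isCont_def)
  show ?case
  proof (rule lhopital[OF lim0])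
    show "((\<lambda>x. (x - c) ^ Suc k) \<longlongrightarrow> 0) (at c)"
      by (auto intro!: tendsto_eq_intros)
    show "\<forall>\<^sub>F x in at c. (x - c) ^ Suc k \<noteq> 0"
      unfolding eventually_at_filter by simp
    show "\<forall>\<^sub>F x in at c. real (Suc k) * (x - c) ^ k \<noteq> 0"
      unfolding eventually_at_filter by simp
    show "\<forall>\<^sub>F x in at c. ((\<lambda>x. Re (f x)) has_real_derivative Re (vderiv 1 f x)) (at x)"
      using Re_has_derivative[OF Suc.prems(1)] by simp
    show "\<forall>\<^sub>F x in at c. ((\<lambda>x. (x - c) ^ Suc k) has_real_derivative real (Suc k) * (x - c) ^ k) (at x)"
      by (auto intro!: always_eventually derivative_eq_intros simp del: power_Suc)
    have "((\<lambda>x. (Re (vderiv 1 f x) / (x - c) ^ k) / real (Suc k))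
        \<longlongrightarrow> (Re (vderiv k (vderiv 1 f) c) / fact k) / real (Suc k)) (at c)"
      by (intro tendsto_divide Suc.IH smooth_fun_vderiv Suc.prems van' tendsto_const) simp
    then show "((\<lambda>x. Re (vderiv 1 f x) / (real (Suc k) * (x - c) ^ k))
        \<longlongrightarrow> Re (vderiv (Suc k) f c) / fact (Suc k)) (at c)"
      unfolding vderiv_Suc'[symmetric] by (simp add: mult.commute del: vderiv.simps)
  qed
qed

lemma Re_quotient_tendsto:
  assumes "smooth_fun f" "smooth_fun g" "vanishes f c k" "vanishes g c k" "Re (vderiv k g c) \<noteq> 0"
  shows "((\<lambda>x. Re (f x) / Re (g x)) \<longlongrightarrow> Re (vderiv k f c) / Re (vderiv k g c)) (at c)"
proof -
  have "((\<lambda>x. (Re (f x) / (x - c) ^ k) / (Re (g x) / (x - c) ^ k))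
      \<longlongrightarrow> (Re (vderiv k f c) / fact k) / (Re (vderiv k g c) / fact k)) (at c)"
    using assms by (intro tendsto_divide Re_quotient_power_tendsto) auto
  moreover have "\<forall>\<^sub>F x in at c. (Re (f x) / (x - c) ^ k) / (Re (g x) / (x - c) ^ k) = Re (f x) / Re (g x)"
    by (auto simp: eventually_at_filter)
  ultimately have "((\<lambda>x. Re (f x) / Re (g x))
      \<longlongrightarrow> (Re (vderiv k f c) / fact k) / (Re (vderiv k g c) / fact k)) (at c)"
    by (rule Lim_transform_eventually)
  then show ?thesis by simp
qed

section \<open>Real values and positivity\<close>

lemma vderiv_real_valued:
  assumes "smooth_fun p" "\<And>x. p x = complex_of_real (Re (p x))"
  shows "vderiv k p x = complex_of_real (Re (vderiv k p x))"
proof -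
  have "(\<lambda>x. cnj (p x)) = p"
  proof
    show "cnj (p x) = p x" for x using assms(2)[of x] by (metis complex_cnj_complex_of_real)
  qed
  then have "cnj (vderiv k p x) = vderiv k p x"
    using vderiv_cnj[OF assms(1), of k] by (metis (no_types))
  then show ?thesis by (simp add: complex_eq_iff)
qed

lemma continuous_no_zero_pos:
  fixes u :: "real \<Rightarrow> real"
  assumes cont: "\<And>x. isCont u x" and nz: "\<And>x. x \<in> {a<..<b} \<Longrightarrow> u x \<noteq> 0"
    and y: "y \<in> {a<..<b}" "u y > 0" and x: "x \<in> {a<..<b}"
  shows "u x > 0"
proof (rule ccontr)
  assume "\<not> u x > 0"
  then have "0 \<in> closed_segment (u x) (u y)"
    using y by (auto simp: closed_segment_eq_real_ivl)
  moreover have "closed_segment (u x) (u y) \<subseteq> u ` closed_segment x y"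
  proof -
    have "connected (u ` closed_segment x y)"
      using cont by (intro connected_continuous_image continuous_at_imp_continuous_on connected_segment) auto
    then show ?thesis
      by (intro closed_segment_subset) (auto simp: is_interval_connected_1[symmetric] is_interval_convex)
  qed
  ultimately obtain z where z: "z \<in> closed_segment x y" "u z = 0" by auto
  then have "z \<in> {a<..<b}"
    using x y by (auto simp: closed_segment_eq_real_ivl split: if_splits)
  with z nz show False by blast
qed

lemma Re_isCont: "smooth_fun f \<Longrightarrow> isCont (\<lambda>x. Re (f x)) x"
  using Re_has_derivative DERIV_isCont by blast

text \<open>An interior zero would be one too many for the Chebyshev system, so the sign is
  constant; the normalisation at \<open>a\<close> makes it positive near \<open>a\<close>.\<close>

lemma bernstein_pos:
  assumes "conj_sym mus" "a < b" "narrow a b mus" "k < length mus" "is_bernstein a b mus k p"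
    and "x \<in> {a<..<b}"
  shows "Re (p x) > 0"
proof -
  note p = assms(5)[unfolded is_bernstein_def zero_order_iff]
  have s: "smooth_fun p" using p by (auto simp: E_space_iff)
  have nz: "Re (p z) \<noteq> 0" if "z \<in> {a<..<b}" for z
  proof
    assume "Re (p z) = 0"
    then have "p z = 0" using bernstein_real[OF assms(1-5), of z] by simp
    then have "p = (\<lambda>x. 0)"
      using p that assms(4)
      by (intro E_space_chebyshev[OF assms(1-3), of p k "length mus - 1 - k" "{z}"]) auto
    then have "vderiv k p a = 0" using vderiv_cmult[OF s, of k 0] by simp
    then show False using p by simp
  qed
  have "((\<lambda>x. Re (p x) / (x - a) ^ k) \<longlongrightarrow> 1 / fact k) (at a)"
    using Re_quotient_power_tendsto[OF s, of a k] p by simp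
  then have "((\<lambda>x. Re (p x) / (x - a) ^ k) \<longlongrightarrow> 1 / fact k) (at_right a)"
    by (rule filterlim_mono) (auto simp: at_le)
  then have "\<forall>\<^sub>F x in at_right a. Re (p x) / (x - a) ^ k > 0"
    by (rule order_tendstoD) simp
  moreover have "\<forall>\<^sub>F x in at_right a. x \<in> {a<..<b}"
    using assms(2) by (rule eventually_at_right_real)
  ultimately have "\<forall>\<^sub>F x in at_right a. x \<in> {a<..<b} \<and> Re (p x) > 0"
    by eventually_elim (auto simp: zero_less_divide_iff)
  then obtain y where y: "y \<in> {a<..<b}" "Re (p y) > 0"
    using eventually_happens trivial_limit_at_right_real by blast
  show ?thesis
    using continuous_no_zero_pos[of "\<lambda>x. Re (p x)" a b y x] nz y assms(6) Re_isCont[OF s] by blast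
qed

text \<open>The operator is monic, and its lower-order terms involve only derivatives that vanish at
  \<open>c\<close>.\<close>

lemma diff_op_eq_vderiv_if_vanishes:
  assumes "smooth_fun f" "vanishes f c (length mus)"
  shows "diff_op mus f c = vderiv (length mus) f c"
  using assms
proof (induction mus arbitrary: f rule: rev_induct)
  case (snoc mu mus)
  have "vanishes f c (Suc (length mus))" using snoc.prems(2) by simp
  then have "diff_op mus (dstep mu f) c = vderiv (length mus) (dstep mu f) c"
    using vanishes_dstep[OF snoc.prems(1)]
    by (intro snoc.IH smooth_fun_dstep snoc.prems) (metis diff_Suc_1)
  then show ?case
    using snoc.prems unfolding diff_op_append diff_op_single
    by (simp add: vderiv_dstep vanishes_def del: vderiv.simps)
qed simp

section \<open>Monotonicity in the real eigenvalue\<close>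

text \<open>The image of \<open>p\<close> is annihilated by the factor of \<open>l\<close>, hence a
  multiple of an exponential; the multiple is real since \<open>p\<close> and the operator are. Its
  sign can therefore be read off at any point, in particular at 0.\<close>

lemma diff_op_bernstein:
  assumes "conj_sym mus" "a < b" "narrow a b (complex_of_real l # mus)" "k \<le> length mus"
    and "is_bernstein a b (complex_of_real l # mus) k p"
  shows "diff_op mus p x = complex_of_real (Re (diff_op mus p 0) * exp (l * x))"
proof -
  have p: "smooth_fun p" "dstep l (diff_op mus p) = (\<lambda>x. 0)"
    using assms(5) unfolding is_bernstein_def E_space_iff diff_op_Cons' by auto
  obtain xs where xs: "conj_list xs" "mset xs = mset mus"
    using assms(1) unfolding conj_sym_def by blast
  have "p x = complex_of_real (Re (p x))" for x
    by (rule bernstein_real[OF conj_sym_Cons_real[OF assms(1)] assms(2,3) _ assms(5)])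
      (use assms(4) in simp)
  then have "cnj (p x) = p x" for x
    by (metis complex_cnj_complex_of_real)
  then have "(\<lambda>x. cnj (p x)) = p" by (rule ext)
  then have "cnj (diff_op xs p 0) = diff_op xs p 0"
    using fun_cong[OF diff_op_cnj[OF xs(1) p(1)], of 0] by simp
  then have "diff_op mus p 0 = complex_of_real (Re (diff_op mus p 0))"
    using diff_op_mset_cong[OF xs(2) p(1)] by (simp add: complex_eq_iff)
  moreover have "diff_op mus p x = diff_op mus p 0 * exp (complex_of_real l * complex_of_real (x - 0))"
    by (rule dstep_eq_0_imp_exp[OF smooth_fun_diff_op[OF p(1)] p(2)])
  moreover have "exp (complex_of_real l * complex_of_real (x - 0)) = complex_of_real (exp (l * x))"
    by (simp add: exp_of_real[symmetric])
  ultimately show ?thesis by (metis of_real_mult)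
qed

text \<open>Near \<open>a\<close> the function \<open>p\<close> dominates every multiple of
  \<open>q\<close>, and near \<open>b\<close> the roles are reversed, so p - t q changes sign in
  between.\<close>

lemma ex_sign_change_zero:
  assumes sm: "smooth_fun p" "smooth_fun q" and ab: "a < b" and t: "(t::real) > 0"
    and pos: "\<And>x. x \<in> {a<..<b} \<Longrightarrow> Re (p x) > 0" "\<And>x. x \<in> {a<..<b} \<Longrightarrow> Re (q x) > 0"
    and lim_a: "((\<lambda>x. Re (q x) / Re (p x)) \<longlongrightarrow> 0) (at a)"
    and lim_b: "((\<lambda>x. Re (p x) / Re (q x)) \<longlongrightarrow> 0) (at b)"
  shows "\<exists>z\<in>{a<..<b}. Re (p z) = t * Re (q z)"
proof (rule ccontr)
  let ?u = "\<lambda>x. Re (p x) - t * Re (q x)"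
  assume "\<not> ?thesis"
  then have nz: "?u x \<noteq> 0" if "x \<in> {a<..<b}" for x using that by auto
  have "((\<lambda>x. Re (q x) / Re (p x)) \<longlongrightarrow> 0) (at_right a)"
    using lim_a by (rule filterlim_mono) (auto simp: at_le)
  then have "\<forall>\<^sub>F x in at_right a. Re (q x) / Re (p x) < 1 / t"
    by (rule order_tendstoD) (use t in simp)
  moreover have "\<forall>\<^sub>F x in at_right a. x \<in> {a<..<b}"
    using ab by (rule eventually_at_right_real)
  ultimately have "\<forall>\<^sub>F x in at_right a. x \<in> {a<..<b} \<and> ?u x > 0"
  proof eventually_elim
    case (elim x)
    then show ?case using pos(1)[of x] t by (simp add: field_simps)
  qed
  then obtain y1 where y1: "y1 \<in> {a<..<b}" "?u y1 > 0"
    using eventually_happens trivial_limit_at_right_real by blast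
  have "((\<lambda>x. Re (p x) / Re (q x)) \<longlongrightarrow> 0) (at_left b)"
    using lim_b by (rule filterlim_mono) (auto simp: at_le)
  then have "\<forall>\<^sub>F x in at_left b. Re (p x) / Re (q x) < t"
    by (rule order_tendstoD) (use t in simp)
  moreover have "\<forall>\<^sub>F x in at_left b. x \<in> {a<..<b}"
    using ab by (rule eventually_at_left_real)
  ultimately have "\<forall>\<^sub>F x in at_left b. x \<in> {a<..<b} \<and> ?u x < 0"
  proof eventually_elim
    case (elim x)
    then show ?case using pos(2)[of x] t by (simp add: field_simps)
  qed
  then obtain y2 where y2: "y2 \<in> {a<..<b}" "?u y2 < 0"
    using eventually_happens trivial_limit_at_left_real by blast
  have "isCont ?u x" for x using Re_isCont[OF sm(1)] Re_isCont[OF sm(2)] by (intro continuous_intros)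
  then have "?u y2 > 0"
    using continuous_no_zero_pos[of ?u a b y1 y2] nz y1 y2(1) by blast
  with y2 show False by simp
qed

text \<open>Downward induction on $k$: if consecutive coefficients had the same sign, some
  $p_k - t p_{k+1}$ with $t>0$ would lie in the smaller space $E_{mus}$; it is positive near $a$
  and negative near $b$, so it has one zero too many for that Chebyshev system.\<close>

lemma diff_op_bernstein_sign:
  assumes sym: "conj_sym mus" and ab: "a < b" and nar: "narrow a b (complex_of_real l # mus)"
    and "k + d = length mus"
  shows "0 < (-1) ^ d * Re (diff_op mus (bernstein a b (complex_of_real l # mus) k) 0)"
  using assms(4)
proof (induction d arbitrary: k)
  \<comment> \<open>With \<open>k = length mus\<close> all zeros sit at \<open>a\<close>, where the
    operator reduces to its leading derivative; the normalisation makes its value there 1.\<close>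
  case 0
  let ?p = "bernstein a b (complex_of_real l # mus) k"
  have P: "is_bernstein a b (complex_of_real l # mus) k ?p"
    using 0 by (intro is_bernstein_bernstein conj_sym_Cons_real sym ab nar) simp
  then have "smooth_fun ?p" "vanishes ?p a (length mus)" "vderiv (length mus) ?p a = 1"
    using 0 by (auto simp: is_bernstein_def E_space_iff zero_order_iff)
  then have "diff_op mus ?p a = 1" using diff_op_eq_vderiv_if_vanishes by simp
  moreover have "diff_op mus ?p a = complex_of_real (Re (diff_op mus ?p 0) * exp (l * a))"
    using 0 by (intro diff_op_bernstein[OF sym ab nar _ P]) simp
  ultimately have "Re (diff_op mus ?p 0) * exp (l * a) = 1" by (metis of_real_eq_1_iff)
  then have "0 < Re (diff_op mus ?p 0) * exp (l * a)" by simp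
  then show ?case by (simp add: zero_less_mult_iff)
next
  case (Suc d)
  let ?ms = "complex_of_real l # mus"
  define p where "p = bernstein a b ?ms k"
  define q where "q = bernstein a b ?ms (Suc k)"
  have sym': "conj_sym ?ms" by (rule conj_sym_Cons_real[OF sym])
  have nar': "narrow a b mus" using nar by (simp add: narrow_def)
  have k: "k < length ?ms" "Suc k < length ?ms" using Suc.prems by auto
  have bp: "is_bernstein a b ?ms k p" and bq: "is_bernstein a b ?ms (Suc k) q"
    unfolding p_def q_def by (rule is_bernstein_bernstein[OF sym' ab nar k(1)])
      (rule is_bernstein_bernstein[OF sym' ab nar k(2)])
  note real = bernstein_real[OF sym' ab nar k(1) bp] bernstein_real[OF sym' ab nar k(2) bq]
  have len: "length ?ms - 1 - k = Suc d" "length ?ms - 1 - Suc k = d" using Suc.prems by auto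
  have p: "smooth_fun p" "vanishes p a k" "vanishes p b (Suc d)" "vderiv k p a = 1"
    and q: "smooth_fun q" "vanishes q a (Suc k)" "vanishes q b d" "vderiv d q b \<noteq> 0"
    using bp bq unfolding is_bernstein_def zero_order_iff E_space_iff len by auto
  have van: "vanishes q a k" "vanishes p b d" using p q by (auto simp: vanishes_Suc)
  define cp where "cp = Re (diff_op mus p 0)"
  define cq where "cq = Re (diff_op mus q 0)"
  have dp: "diff_op mus p x = complex_of_real (cp * exp (l * x))" for x
    unfolding cp_def using Suc.prems by (intro diff_op_bernstein[OF sym ab nar _ bp]) simp
  have dq: "diff_op mus q x = complex_of_real (cq * exp (l * x))" for x
    unfolding cq_def using Suc.prems by (intro diff_op_bernstein[OF sym ab nar _ bq]) simp
  have cq: "0 < (-1) ^ d * cq"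
    using Suc.IH[of "Suc k"] Suc.prems by (simp add: cq_def q_def)
  \<comment> \<open>If \<open>cp\<close> were 0, then \<open>p\<close> would lie in
    \<open>E_space mus\<close>, for which its \<open>k + Suc d = length mus\<close> endpoint zeros
    are too many.\<close>
  have cp0: "cp \<noteq> 0"
  proof
    assume "cp = 0"
    then have "p \<in> E_space mus" using dp p(1) by (simp add: E_space_def)
    then have "p = (\<lambda>x. 0)"
      using E_space_chebyshev[OF sym ab nar' _ p(2,3), of "{}"] Suc.prems by simp
    then have "vderiv k p a = 0" using vderiv_cmult[OF p(1), of k 0] by simp
    with p(4) show False by simp
  qed
  show ?case
  proof (rule ccontr)
    assume "\<not> ?case"
    then have "0 \<le> (-1) ^ d * cp" by (simp add: cp_def p_def)
    moreover have "(-1) ^ d * cp \<noteq> 0" using cp0 by simp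
    ultimately have cp: "0 < (-1) ^ d * cp" by linarith
    \<comment> \<open>The ratio for which the exponentials in the images of \<open>p\<close> and t q
      cancel.\<close>
    define t where "t = cp / cq"
    have "t = ((-1) ^ d * cp) / ((-1) ^ d * cq)" by (simp add: t_def)
    then have t: "t > 0" using divide_pos_pos[OF cp cq] by (simp only:)
    have "cq \<noteq> 0" using cq by auto
    define r where "r = (\<lambda>x. 1 * p x + (- complex_of_real t) * q x)"
    have "diff_op mus r x = 0" for x
    proof -
      have "diff_op mus r x = 1 * diff_op mus p x + (- complex_of_real t) * diff_op mus q x"
        unfolding r_def diff_op_lincomb[OF p(1) q(1)] ..
      also have "\<dots> = complex_of_real ((cp - t * cq) * exp (l * x))"
        unfolding dp dq by (simp add: algebra_simps)
      also have "cp - t * cq = 0" using \<open>cq \<noteq> 0\<close> by (simp add: t_def)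
      finally show ?thesis by simp
    qed
    moreover have "smooth_fun r" unfolding r_def by (rule smooth_fun_lincomb[OF p(1) q(1)])
    ultimately have rE: "r \<in> E_space mus" by (simp add: E_space_def)
    have "((\<lambda>x. Re (q x) / Re (p x)) \<longlongrightarrow> Re (vderiv k q a) / Re (vderiv k p a)) (at a)"
      by (intro Re_quotient_tendsto p q van) (use p in simp)
    moreover have vq: "vderiv k q a = 0" using q(2) by (simp add: vanishes_Suc)
    ultimately have la: "((\<lambda>x. Re (q x) / Re (p x)) \<longlongrightarrow> 0) (at a)" by simp
    have "Re (vderiv d q b) \<noteq> 0"
      using q(4) vderiv_real_valued[OF q(1) real(2), of d b] by auto
    then have "((\<lambda>x. Re (p x) / Re (q x)) \<longlongrightarrow> Re (vderiv d p b) / Re (vderiv d q b)) (at b)"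
      by (intro Re_quotient_tendsto p q van)
    moreover have "vderiv d p b = 0" using p(3) by (simp add: vanishes_Suc)
    ultimately have lb: "((\<lambda>x. Re (p x) / Re (q x)) \<longlongrightarrow> 0) (at b)" by simp
    have "\<exists>z\<in>{a<..<b}. Re (p z) = t * Re (q z)"
      using bernstein_pos[OF sym' ab nar k(1) bp] bernstein_pos[OF sym' ab nar k(2) bq]
      by (intro ex_sign_change_zero[OF p(1) q(1) ab t _ _ la lb])
    then obtain z where z: "z \<in> {a<..<b}" "Re (p z) = t * Re (q z)" by blast
    have "p z = complex_of_real t * q z" using real(1)[of z] real(2)[of z] z(2) by (metis of_real_mult)
    then have rz: "r z = 0" by (simp add: r_def)
    \<comment> \<open>The endpoints account for \<open>k + d = length mus - 1\<close> zeros, and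
      \<open>z\<close> is the missing one.\<close>
    have "r = (\<lambda>x. 0)"
    proof (rule E_space_chebyshev[OF sym ab nar' rE, where S = "{z}"])
      show "vanishes r a k" "vanishes r b d"
        unfolding r_def using vanishes_lincomb[OF p(1) q(1)] p(2) van q(3) by blast+
    qed (use z rz Suc.prems in auto)
    then have "vderiv k r a = 0" using vderiv_cmult[OF p(1), of k 0] by simp
    moreover have "vderiv k r a = 1"
      unfolding r_def vderiv_lincomb[OF p(1) q(1)] using p(4) vq by simp
    ultimately show False by simp
  qed
qed

lemma bernstein_diff_eq:
  fixes l0 l1 a b :: real
  assumes sym: "conj_sym ls" and ab: "a < b" and nar: "narrow a b ls" and k: "k \<le> length ls"
    and l: "l0 < l1"
  shows "\<exists>s::real. s > 0 \<and> (\<forall>x. bernstein a b (complex_of_real l1 # ls) k x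
      - bernstein a b (complex_of_real l0 # ls) k x
      = complex_of_real s * bernstein a b (complex_of_real l1 # complex_of_real l0 # ls) (Suc k) x)"
proof -
  define p where "p = bernstein a b (complex_of_real l0 # ls) k"
  define q where "q = bernstein a b (complex_of_real l1 # ls) k"
  define P where "P = bernstein a b (complex_of_real l1 # complex_of_real l0 # ls) (Suc k)"
  let ?m0 = "complex_of_real l0 # ls" and ?m1 = "complex_of_real l1 # ls"
    and ?m2 = "complex_of_real l1 # complex_of_real l0 # ls"
  have syms: "conj_sym ?m0" "conj_sym ?m1" "conj_sym ?m2" by (intro conj_sym_Cons_real sym)+
  have nars: "narrow a b ?m0" "narrow a b ?m1" "narrow a b ?m2" using nar by (auto simp: narrow_def)
  have bp: "is_bernstein a b ?m0 k p"
    unfolding p_def using k by (intro is_bernstein_bernstein syms ab nars) simp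
  have bq: "is_bernstein a b ?m1 k q"
    unfolding q_def using k by (intro is_bernstein_bernstein syms ab nars) simp
  have bP: "is_bernstein a b ?m2 (Suc k) P"
    unfolding P_def using k by (intro is_bernstein_bernstein syms ab nars) simp
  \<comment> \<open>The exact order at \<open>b\<close> of all three functions: \<open>P\<close> has
    one more eigenvalue than \<open>p\<close> and \<open>q\<close>, but also an index higher by
    one.\<close>
  define d where "d = length ls - k"
  have d: "k + d = length ls" "Suc k + d = length ?m0" using k by (auto simp: d_def)
  have p: "p \<in> E_space ?m0" "smooth_fun p" "vanishes p a k" "vanishes p b d" "vderiv k p a = 1"
    and q: "q \<in> E_space ?m1" "smooth_fun q" "vanishes q a k" "vanishes q b d" "vderiv k q a = 1"
    and P: "P \<in> E_space ?m2" "smooth_fun P" "vanishes P a (Suc k)" "vanishes P b d" "vderiv (Suc k) P a = 1"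
    using bp bq bP by (auto simp: is_bernstein_def zero_order_iff E_space_iff d_def simp del: vderiv.simps)
  define f where "f = (\<lambda>x. q x - p x)"
  have fs: "smooth_fun f" unfolding f_def by (intro smooth_fun_diff p q)
  have "p \<in> E_space ?m2" by (rule E_space_Cons_subset[OF p(1)])
  moreover have "q \<in> E_space ?m2"
    using E_space_Cons_subset[OF q(1), of "complex_of_real l0"]
      E_space_mset_cong[of "complex_of_real l0 # complex_of_real l1 # ls" ?m2] by simp
  ultimately have fE: "f \<in> E_space ?m2" unfolding f_def by (intro E_space_diff)
  have f: "vanishes f a (Suc k)" "vanishes f b d"
    unfolding f_def using vanishes_diff[OF q(2) p(2)] p q
    by (auto simp: vanishes_Suc vderiv_diff[OF q(2) p(2)])
  have real: "p x = complex_of_real (Re (p x))" "q x = complex_of_real (Re (q x))" for x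
    using bernstein_real[OF syms(1) ab nars(1) _ bp] bernstein_real[OF syms(2) ab nars(2) _ bq] k by auto
  then have "f x = complex_of_real (Re (f x))" for x
    unfolding f_def by (metis of_real_diff minus_complex.sel(1))
  then have freal: "vderiv (Suc k) f a = complex_of_real (Re (vderiv (Suc k) f a))"
    by (rule vderiv_real_valued[OF fs])
  \<comment> \<open>Forced by comparing derivatives of order \<open>Suc k\<close> at
    \<open>a\<close>, where \<open>P\<close> is normalised. Subtracting \<open>s\<close> times
    \<open>P\<close> then gives order \<open>k + 2\<close> at \<open>a\<close> and \<open>d\<close>
    at \<open>b\<close>, in total the length of \<open>?m2\<close>.\<close>
  define s where "s = Re (vderiv (Suc k) f a)"
  let ?g = "\<lambda>x. 1 * f x + (- complex_of_real s) * P x"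
  have "?g = (\<lambda>x. 0)"
  proof (rule E_space_chebyshev[OF syms(3) ab nars(3), where S = "{}"])
    show "?g \<in> E_space ?m2" by (intro E_space_lincomb fE P)
    show "vanishes ?g a (Suc (Suc k))"
      unfolding vanishes_Suc[of _ _ "Suc k"] vderiv_lincomb[OF fs P(2)]
    proof
      show "vanishes ?g a (Suc k)" by (rule vanishes_lincomb[OF fs P(2) f(1) P(3)])
    qed (use P(5) freal in \<open>simp add: s_def del: vderiv.simps\<close>)
    show "vanishes ?g b d" by (rule vanishes_lincomb[OF fs P(2) f(2) P(4)])
  qed (use d in auto)
  then have feq: "f x = complex_of_real s * P x" for x
    using fun_cong[of ?g "\<lambda>x. 0" x] by simp
  define c where "c = Re (diff_op ls q 0)"
  define C where "C = Re (diff_op ?m0 P 0)"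
  have c: "0 < (-1) ^ d * c"
    unfolding c_def q_def by (rule diff_op_bernstein_sign[OF sym ab nars(2) d(1)])
  \<comment> \<open>Here \<open>?m0\<close> takes the place of \<open>ls\<close>, with the index
    raised by one, so the exponent is the same \<open>d\<close>.\<close>
  have C: "0 < (-1) ^ d * C"
    unfolding C_def P_def by (rule diff_op_bernstein_sign[OF syms(1) ab nars(3) d(2)])
  have "diff_op ?m0 f 0 = complex_of_real ((l1 - l0) * c)"
  proof -
    have "diff_op ls q x = complex_of_real c * exp (complex_of_real l1 * complex_of_real x)" for x
      using diff_op_bernstein[OF sym ab nars(2) k bq, of x] unfolding c_def[symmetric]
      by (simp flip: exp_of_real)
    then have "diff_op ls q = (\<lambda>x. complex_of_real c * exp (complex_of_real l1 * complex_of_real x))"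
      by (rule ext)
    then have "diff_op ?m0 q 0 = (complex_of_real l1 - complex_of_real l0) * complex_of_real c"
      unfolding diff_op_Cons' by (simp add: dstep_exp)
    moreover have "diff_op ?m0 p 0 = 0" using p(1) by (simp add: E_space_def del: diff_op.simps)
    moreover have "diff_op ?m0 f 0 = diff_op ?m0 q 0 - diff_op ?m0 p 0"
      using diff_op_lincomb[OF q(2) p(2), of ?m0 1 "-1"] by (simp add: f_def del: diff_op.simps)
    ultimately show ?thesis by (simp only: of_real_mult of_real_diff diff_0_right)
  qed
  moreover have "diff_op ?m0 f 0 = complex_of_real s * diff_op ?m0 P 0"
  proof -
    have "f = (\<lambda>x. complex_of_real s * P x + 0 * P x)" using feq by auto
    then show ?thesis using diff_op_lincomb[OF P(2) P(2), of ?m0 s 0] by (simp del: diff_op.simps)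
  qed
  ultimately have "Re (complex_of_real s * diff_op ?m0 P 0) = (l1 - l0) * c" by (metis Re_complex_of_real)
  then have sC: "s * C = (l1 - l0) * c" by (simp add: C_def del: diff_op.simps)
  have "s * ((-1) ^ d * C) = (l1 - l0) * ((-1) ^ d * c)" using sC by (simp add: mult.left_commute)
  moreover have "(l1 - l0) * ((-1) ^ d * c) > 0" using l c by simp
  ultimately have "s > 0" using C by (metis zero_less_mult_pos2)
  then show ?thesis
    using feq unfolding f_def p_def q_def P_def by blast
qed

section \<open>From the stated hypotheses to the theorem\<close>

lemma narrow_if_less_max_im:
  assumes "max_im ls = 0 \<or> b - a < pi / max_im ls" "a < b"
  shows "narrow a b ls"
  unfolding narrow_def
proof (intro ballI impI)
  fix mu assume mu: "mu \<in> set ls" "Im mu \<noteq> 0"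
  have "\<bar>Im mu\<bar> \<le> max_im ls"
    unfolding max_im_def using mu(1) by (intro Max_ge) auto
  then have "max_im ls \<noteq> 0" "pi / max_im ls \<le> pi / \<bar>Im mu\<bar>"
    using mu(2) by (auto intro!: divide_left_mono mult_pos_pos)
  then show "b - a < pi / \<bar>Im mu\<bar>" using assms(1) by linarith
qed

theorem mainTheorem14:
  fixes ls :: "complex list" and a b l0 l1 :: real and k :: nat
  assumes "closed_under_cnj ls"
    and "a < b"
    and "max_im ls = 0 \<or> b - a < pi / max_im ls"
    and "l0 < l1"
    and "k < length ls + 1"
  shows "(\<exists>L::real. ((\<lambda>x. bernstein a b (complex_of_real l0 # ls) k x
                          / bernstein a b (complex_of_real l1 # ls) k x)
              \<longlongrightarrow> complex_of_real L) (at b) \<and> L < 1)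
     \<and> (\<forall>x\<in>{a<..<b}. \<exists>g::real \<Rightarrow> real.
            (\<forall>l. bernstein a b (complex_of_real l # ls) k x = complex_of_real (g l))
            \<and> strict_mono g)"
proof -
  note ab = assms(2)
  have sym: "conj_sym ls" by (rule closed_under_cnj_imp_conj_sym[OF assms(1)])
  have nar: "narrow a b ls" by (rule narrow_if_less_max_im[OF assms(3) ab])
  have k: "k \<le> length ls" using assms(5) by simp
  let ?ms = "\<lambda>l. complex_of_real l # ls"
  let ?p = "\<lambda>l. bernstein a b (?ms l) k"
  have syms: "conj_sym (?ms l)" and nars: "narrow a b (?ms l)" for l
    using conj_sym_Cons_real[OF sym] nar by (auto simp: narrow_def)
  have bp: "is_bernstein a b (?ms l) k (?p l)" for l
    using k by (intro is_bernstein_bernstein syms ab nars) simp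
  have real: "?p l x = complex_of_real (Re (?p l x))" for l x
    using k by (intro bernstein_real[OF syms ab nars _ bp]) simp
  have mono: "Re (?p l x) < Re (?p l' x)" if "l < l'" "x \<in> {a<..<b}" for l l' x
  proof -
    let ?m2 = "complex_of_real l' # ?ms l"
    obtain s :: real where s: "s > 0" "?p l' x - ?p l x = complex_of_real s * bernstein a b ?m2 (Suc k) x"
      using bernstein_diff_eq[OF sym ab nar k \<open>l < l'\<close>] by blast
    have sym2: "conj_sym ?m2" and nar2: "narrow a b ?m2"
      using conj_sym_Cons_real[OF syms] nars by (auto simp: narrow_def)
    have k2: "Suc k < length ?m2" using k by simp
    have "Re (bernstein a b ?m2 (Suc k) x) > 0"
      by (rule bernstein_pos[OF sym2 ab nar2 k2 is_bernstein_bernstein[OF sym2 ab nar2 k2] that(2)])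
    then have "Re (?p l' x - ?p l x) > 0" using s by simp
    then show ?thesis by simp
  qed
  define d where "d = length ls - k"
  have p: "smooth_fun (?p l)" "vanishes (?p l) b d" "vderiv d (?p l) b \<noteq> 0" for l
    using bp[of l] by (auto simp: is_bernstein_def E_space_iff zero_order_iff d_def)
  have vreal: "vderiv d (?p l) b = complex_of_real (Re (vderiv d (?p l) b))" for l
    by (rule vderiv_real_valued[OF p(1) real])
  then have nz: "Re (vderiv d (?p l) b) \<noteq> 0" for l using p(3)[of l] by (metis of_real_0)
  define L where "L = Re (vderiv d (?p l0) b) / Re (vderiv d (?p l1) b)"
  \<comment> \<open>Both functions have order exactly \<open>d\<close> at \<open>b\<close>, so the
    two-sided limit is the ratio of their derivatives of order \<open>d\<close>.\<close>
  have lim: "((\<lambda>x. Re (?p l0 x) / Re (?p l1 x)) \<longlongrightarrow> L) (at b)"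
    unfolding L_def by (intro Re_quotient_tendsto p nz)
  have "L \<le> 1"
  proof (rule tendsto_upperbound)
    show "((\<lambda>x. Re (?p l0 x) / Re (?p l1 x)) \<longlongrightarrow> L) (at_left b)"
      using lim by (rule filterlim_mono) (auto simp: at_le)
    have "\<forall>\<^sub>F x in at_left b. x \<in> {a<..<b}"
      using ab by (rule eventually_at_left_real)
    then show "\<forall>\<^sub>F x in at_left b. Re (?p l0 x) / Re (?p l1 x) \<le> 1"
    proof eventually_elim
      case (elim x)
      have "Re (?p l1 x) > 0"
        using k by (intro bernstein_pos[OF syms ab nars _ bp elim]) simp
      then show ?case using mono[OF assms(4) elim] by simp
    qed
  qed simp
  \<comment> \<open>Equality would make the derivative of order \<open>d\<close> of the difference
    vanish at \<open>b\<close>; but the difference is a positive multiple of a Bernstein function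
    whose order there is exactly \<open>d\<close>.\<close>
  moreover have "L \<noteq> 1"
  proof
    assume "L = 1"
    then have "Re (vderiv d (?p l0) b) = Re (vderiv d (?p l1) b)" using nz[of l1] by (simp add: L_def)
    then have eq: "vderiv d (?p l1) b - vderiv d (?p l0) b = 0"
      using vreal[of l0] vreal[of l1] by simp
    let ?m2 = "complex_of_real l1 # ?ms l0"
    let ?P = "bernstein a b ?m2 (Suc k)"
    obtain s :: real where s: "s > 0" "\<And>x. ?p l1 x - ?p l0 x = complex_of_real s * ?P x"
      using bernstein_diff_eq[OF sym ab nar k assms(4)] by blast
    have "is_bernstein a b ?m2 (Suc k) ?P"
      using k conj_sym_Cons_real[OF syms] nars
      by (intro is_bernstein_bernstein ab) (auto simp: narrow_def)
    then have P: "smooth_fun ?P" "vderiv d ?P b \<noteq> 0"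
      by (auto simp: is_bernstein_def E_space_iff zero_order_iff d_def)
    have "vderiv d (\<lambda>x. ?p l1 x - ?p l0 x) b = complex_of_real s * vderiv d ?P b"
      unfolding s(2) vderiv_cmult[OF P(1)] ..
    then show False using eq s(1) P(2) by (simp add: vderiv_diff[OF p(1) p(1)])
  qed
  ultimately have "L < 1" by simp
  moreover have "((\<lambda>x. ?p l0 x / ?p l1 x) \<longlongrightarrow> complex_of_real L) (at b)"
  proof -
    have "(\<lambda>x. ?p l0 x / ?p l1 x) = (\<lambda>x. complex_of_real (Re (?p l0 x) / Re (?p l1 x)))"
      using real by (metis of_real_divide)
    then show ?thesis using tendsto_of_real[OF lim, where 'a = complex] by (simp only:)
  qed
  moreover have "\<exists>g::real \<Rightarrow> real. (\<forall>l. ?p l x = complex_of_real (g l)) \<and> strict_mono g"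
    if "x \<in> {a<..<b}" for x
    using real mono[OF _ that] by (intro exI[of _ "\<lambda>l. Re (?p l x)"]) (auto simp: strict_mono_def)
  ultimately show ?thesis by blast
qed

end
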